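(* Let $q\ge 2$ be an integer and let $A_1,A_2,\ldots,A_d$ be positive integers. For $N\ge 1$ let $n$ be chosen uniformly at random from $\{0,1,\ldots,N-1\}$. Then the random vector \[ (s_q(A_1 n), s_q(A_2 n), \ldots, s_q(A_d n)) \] satisfies a $d$-dimensional central limit theorem with asymptotic mean vector $\big(\tfrac{q-1}2,\ldots,\tfrac{q-1}2\big)\cdot\log_q N$ and asymptotic covariance matrix $\Sigma\cdot\log_q N$, where $\Sigma$ is a positive semi-definite $d\times d$ matrix; that is, as $N\to\infty$, \[ \frac{(s_q(A_1 n), \ldots, s_q(A_d n)) - \big(\tfrac{q-1}2,\ldots,\tfrac{q-1}2\big)\log_q N}{\sqrt{\log_q N}} \] converges in distribution to a centered Gaussian vector with covariance matrix $\Sigma$. If moreover $q$ is prime and none of $A_1,\ldots,A_d$ is divisible by $q$, then \[ \Sigma = \left( \frac{q^2-1}{12}\,\frac{\gcd(A_i,A_j)^2}{A_i A_j}\right)_{1\le i,j\le d}. \]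
   Context: For an integer $q\ge2$ and a non-negative integer $m$, $s_q(m)=\sum_{j\ge0}\varepsilon_j(m)$ denotes the base-$q$ sum-of-digits function, where $\varepsilon_j(m)\in\{0,\ldots,q-1\}$ is the $j$-th digit of the base-$q$ expansion $m=\sum_{j\ge0}\varepsilon_j(m)q^j$. *)

theory Defs
  imports "HOL-Probability.Probability" "HOL-Computational_Algebra.Primes"
begin

definition digit :: "nat \<Rightarrow> nat \<Rightarrow> nat \<Rightarrow> nat" where
  "digit q j m = m div q ^ j mod q"

text \<open>For \<open>q \<ge> 2\<close> only finitely many digits are nonzero, so summing over the support gives the
  full sum over \<open>j \<ge> 0\<close>.\<close>

definition digit_sum :: "nat \<Rightarrow> nat \<Rightarrow> nat" where
  "digit_sum q m = (\<Sum>j | digit q j m \<noteq> 0. digit q j m)"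

lemma digit_eq_0:
  assumes "q \<ge> 2" "m \<le> j"
  shows "digit q j m = 0"
proof -
  have "j < 2 ^ j" by (rule less_exp)
  also have "\<dots> \<le> q ^ j" using assms(1) by (rule power_mono) simp
  finally have "j < q ^ j" .
  with assms(2) have "m < q ^ j" by (rule le_less_trans)
  then have "m div q ^ j = 0" by (rule div_less)
  then show ?thesis by (simp only: digit_def mod_0)
qed

lemma digit_support_subset:
  assumes "q \<ge> 2"
  shows "{j. digit q j m \<noteq> 0} \<subseteq> {..<m}"
proof
  fix j assume "j \<in> {j. digit q j m \<noteq> 0}"
  then have "digit q j m \<noteq> 0" by (rule CollectD)
  then have "\<not> m \<le> j" by (rule contrapos_nn) (rule digit_eq_0[OF assms])
  then show "j \<in> {..<m}" by simp
qed

lemma finite_digit_support: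
  assumes "q \<ge> 2"
  shows "finite {j. digit q j m \<noteq> 0}"
  by (rule finite_subset[OF digit_support_subset[OF assms]]) simp

lemma digit_expansion:
  assumes "q \<ge> 2"
  shows "(\<Sum>j | digit q j m \<noteq> 0. digit q j m * q ^ j) = m"
proof -
  have *: "(\<Sum>j<k. digit q j m * q ^ j) + q ^ k * (m div q ^ k) = m" for k
  proof (induction k)
    case (Suc k)
    have "m div q ^ Suc k = m div q ^ k div q"
      by (simp only: power_Suc2 div_mult2_eq)
    then have "m div q ^ k = q * (m div q ^ Suc k) + digit q k m"
      unfolding digit_def by (metis mult_div_mod_eq)
    then have "q ^ k * (m div q ^ k) = q ^ k * (q * (m div q ^ Suc k) + digit q k m)"
      by (rule arg_cong)
    also have "\<dots> = digit q k m * q ^ k + q ^ Suc k * (m div q ^ Suc k)"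
      by (simp only: distrib_left power_Suc2 mult.assoc) (simp only: ac_simps)
    finally show ?case
      using Suc by (simp only: sum.lessThan_Suc)
  qed simp
  have "m < 2 ^ m" by (rule less_exp)
  also have "\<dots> \<le> q ^ m" using assms by (rule power_mono) simp
  finally have "m div q ^ m = 0" by (rule div_less)
  with *[of m] have "(\<Sum>j<m. digit q j m * q ^ j) = m"
    by (simp only: mult_0_right add_0_right)
  moreover have "(\<Sum>j | digit q j m \<noteq> 0. digit q j m * q ^ j) = (\<Sum>j<m. digit q j m * q ^ j)"
    by (rule sum.mono_neutral_left[OF _ digit_support_subset[OF assms]]) auto
  ultimately show ?thesis by (rule trans[rotated])
qed

definition pos_semidefinite :: "real ^ 'd ^ 'd \<Rightarrow> bool" where
  "pos_semidefinite S \<longleftrightarrow> transpose S = S \<and> (\<forall>x. 0 \<le> x \<bullet> (S *v x))"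

text \<open>The univariate normal law with mean \<open>m\<close> and variance \<open>v \<ge> 0\<close>; variance \<open>0\<close> means the point
  mass at \<open>m\<close>.\<close>

definition normal_law :: "real \<Rightarrow> real \<Rightarrow> real measure" where
  "normal_law m v =
     (if v = 0 then return borel m else density lborel (normal_density m (sqrt v)))"

text \<open>Gaussian vectors may be degenerate: a law on \<open>\<real>\<^sup>d\<close> is Gaussian if all its one-dimensional
  linear images are normal in the sense of \<open>normal_law\<close>.\<close>

definition gaussian_vector_law :: "(real ^ 'd) measure \<Rightarrow> bool" where
  "gaussian_vector_law \<mu> \<longleftrightarrow>
     prob_space \<mu> \<and> sets \<mu> = sets borel \<and>
     (\<forall>t. \<exists>m v. v \<ge> 0 \<and> distr \<mu> borel (\<lambda>x. t \<bullet> x) = normal_law m v)"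

definition centered_gaussian_law :: "real ^ 'd ^ 'd \<Rightarrow> (real ^ 'd) measure \<Rightarrow> bool" where
  "centered_gaussian_law S \<mu> \<longleftrightarrow>
     gaussian_vector_law \<mu> \<and>
     (\<forall>i. (\<integral>x. x $ i \<partial>\<mu>) = 0) \<and>
     (\<forall>i j. (\<integral>x. x $ i * x $ j \<partial>\<mu>) = S $ i $ j)"

text \<open>The library's \<open>weak_conv_m\<close> covers laws on \<open>\<real>\<close> only.\<close>

definition converges_in_law :: "(nat \<Rightarrow> 'a :: topological_space measure) \<Rightarrow> 'a measure \<Rightarrow> bool" where
  "converges_in_law M \<mu> \<longleftrightarrow>
     (\<forall>f :: 'a \<Rightarrow> real. continuous_on UNIV f \<and> bounded (range f) \<longrightarrow>
        (\<lambda>n. \<integral>x. f x \<partial>M n) \<longlonglongrightarrow> (\<integral>x. f x \<partial>\<mu>))"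

end

theory Submission
  imports Defs
begin

text \<open>
  Legendre's formula gives \<open>s_q(m) = (q - 1) \<Sum>\<^sub>l frac (m / q ^ l)\<close>, so a linear combination of the
  \<open>s_q(A\<^sub>i n)\<close> is, up to a bounded error, an additive functional \<open>F\<close> of sawtooth functions of
  \<open>A\<^sub>i n / q ^ l\<close>. Perturbing \<open>n\<close> by \<open>u \<in> [0, 1)\<close> changes \<open>F\<close> only by a bounded amount in \<open>L\<^sup>2\<close>,
  uniformly in the number of digits. Hence, when the digits of a uniform \<open>n < q ^ (k p)\<close> are grouped
  into \<open>k\<close> independent blocks of length \<open>p\<close>, \<open>F\<close> is close in \<open>L\<^sup>2\<close> to the sum of its values on the
  blocks: the error has variance \<open>o(k p)\<close> as first \<open>k\<close> and then \<open>p\<close> grows. The characteristic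
  function of the block sum is a \<open>k\<close>-th power. For general \<open>N\<close>, all but a small proportion of the
  \<open>n < N\<close> lie in complete intervals of length \<open>q ^ (k p)\<close>, with boundedly many leading digits.

  The covariances are computed exactly after refining \<open>n\<close> to \<open>n / \<Prod> A\<^sub>i\<close>: then only the residues of
  \<open>n\<close> modulo \<open>P\<^sub>i q ^ l\<close> occur, where \<open>P\<^sub>i = (\<Prod> A\<^sub>j) / A\<^sub>i\<close>, and the covariance of two
  residues is determined by the gcd of the moduli.

  The step from characteristic functions to weak convergence in several dimensions approximates a
  bounded continuous function on a box by polynomials in \<open>sin (x\<^sub>b / T)\<close>, which are bounded on the
  whole space and are trigonometric polynomials.
\<close>

section \<open>Averages over initial segments\<close>

text \<open>Values in a real vector space let one notion serve real moments and complex
  characteristic functions. For \<open>m = 0\<close> the value is \<open>0\<close>, because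
  \<open>inverse 0 = 0\<close>.\<close>

definition avg :: "nat \<Rightarrow> (nat \<Rightarrow> 'a::real_vector) \<Rightarrow> 'a" where
  "avg m f = (\<Sum>n<m. f n) /\<^sub>R real m"

lemma avg_add: "avg m (\<lambda>n. f n + g n) = avg m f + avg m g"
  by (simp add: avg_def sum.distrib scaleR_add_right)

lemma avg_diff: "avg m (\<lambda>n. f n - g n) = avg m f - avg m g"
  by (simp add: avg_def sum_subtractf scaleR_diff_right)

lemma avg_mult_left: "avg m (\<lambda>n. c * f n) = c * avg m f"
  for c :: "'a::real_algebra"
  by (simp add: avg_def sum_distrib_left)

lemma avg_mult_right: "avg m (\<lambda>n. f n * c) = avg m f * c"
  for c :: "'a::real_algebra"
  by (simp add: avg_def sum_distrib_right)

lemma avg_const: "m > 0 \<Longrightarrow> avg m (\<lambda>n. c) = c"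
  by (simp add: avg_def sum_constant_scaleR)

lemma avg_sum: "avg m (\<lambda>n. \<Sum>i\<in>I. f i n) = (\<Sum>i\<in>I. avg m (f i))"
  unfolding avg_def by (subst sum.swap) (simp add: scaleR_sum_right)

lemma avg_cong: "(\<And>n. n < m \<Longrightarrow> f n = g n) \<Longrightarrow> avg m f = avg m g"
  unfolding avg_def by (metis (mono_tags, lifting) lessThan_iff sum.cong)

lemma avg_mono: "(\<And>n. n < m \<Longrightarrow> f n \<le> g n) \<Longrightarrow> avg m f \<le> avg m g"
  for f :: "nat \<Rightarrow> real"
  unfolding avg_def by (auto intro!: mult_left_mono sum_mono)

lemma avg_nonneg: "(\<And>n. n < m \<Longrightarrow> 0 \<le> f n) \<Longrightarrow> 0 \<le> avg m f"
  for f :: "nat \<Rightarrow> real"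
  unfolding avg_def by (auto intro!: sum_nonneg mult_nonneg_nonneg)

lemma avg_le_const:
  fixes f :: "nat \<Rightarrow> real"
  assumes "m > 0" "\<And>n. n < m \<Longrightarrow> f n \<le> c"
  shows "avg m f \<le> c"
  using avg_mono[of m f "\<lambda>_. c"] assms by (simp add: avg_const)

lemma norm_avg_le: "norm (avg m f) \<le> avg m (\<lambda>n. norm (f n))"
  for f :: "nat \<Rightarrow> 'a::real_normed_vector"
  unfolding avg_def by (auto intro!: mult_left_mono norm_sum)

text \<open>Every \<open>n\<close> splits into its residue \<open>x\<close> modulo \<open>a\<close>
  and its quotient \<open>y\<close>. With \<open>a\<close> a power of \<open>q\<close> this
  separates low digits from high digits.\<close>

lemma sum_lessThan_mult:
  fixes f :: "nat \<Rightarrow> 'a::comm_monoid_add"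
  shows "(\<Sum>n<a*b. f n) = (\<Sum>x<a. \<Sum>y<b. f (x + a * y))"
proof (induction b)
  case (Suc b)
  have "(\<Sum>n<a * Suc b. f n) = (\<Sum>n<a*b. f n) + (\<Sum>n=a*b..<a*b+a. f n)"
    using sum.atLeastLessThan_concat[of 0 "a*b" "a*b+a" f]
    by (simp add: atLeast0LessThan add.commute)
  also have "(\<Sum>n=a*b..<a*b+a. f n) = (\<Sum>x<a. f (x + a * b))"
    using sum.shift_bounds_nat_ivl[of f 0 "a*b" a] by (simp add: atLeast0LessThan add.commute)
  finally show ?case by (simp add: Suc sum.distrib)
qed simp

lemma avg_lessThan_mult: "avg (a * b) f = avg a (\<lambda>x. avg b (\<lambda>y. f (x + a * y)))"
  by (simp add: avg_def sum_lessThan_mult scaleR_sum_right[symmetric] mult.commute)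

lemma avg_mod:
  assumes "b > 0" "a dvd b"
  shows "avg b (\<lambda>n. f (n mod a)) = avg a f"
proof -
  obtain c where c: "b = a * c" using assms(2) by blast
  with assms have "c > 0" by auto
  have "avg b (\<lambda>n. f (n mod a)) = avg a (\<lambda>x. avg c (\<lambda>y. f x))"
    unfolding c avg_lessThan_mult by (intro avg_cong) auto
  also have "\<dots> = avg a f"
    using \<open>c > 0\<close> by (simp add: avg_const)
  finally show ?thesis .
qed

lemma avg_Cauchy_Schwarz:
  fixes f g :: "nat \<Rightarrow> real"
  shows "(avg m (\<lambda>n. f n * g n))\<^sup>2 \<le> avg m (\<lambda>n. (f n)\<^sup>2) * avg m (\<lambda>n. (g n)\<^sup>2)"
proof -
  have "(\<Sum>n<m. f n * g n)\<^sup>2 / (real m)\<^sup>2 \<le> ((\<Sum>n<m. (f n)\<^sup>2) * (\<Sum>n<m. (g n)\<^sup>2)) / (real m)\<^sup>2"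
    by (intro divide_right_mono Cauchy_Schwarz_ineq_sum) auto
  then show ?thesis
    by (simp add: avg_def power_mult_distrib divide_inverse power2_eq_square ac_simps)
qed

lemma abs_avg_mult_le:
  fixes f g :: "nat \<Rightarrow> real"
  assumes "avg m (\<lambda>n. (f n)\<^sup>2) \<le> F" "avg m (\<lambda>n. (g n)\<^sup>2) \<le> G"
  shows "\<bar>avg m (\<lambda>n. f n * g n)\<bar> \<le> sqrt (F * G)"
proof -
  have "(avg m (\<lambda>n. f n * g n))\<^sup>2 \<le> F * G"
    by (rule order_trans[OF avg_Cauchy_Schwarz mult_mono])
      (use assms avg_nonneg[of m "\<lambda>n. (f n)\<^sup>2"] avg_nonneg[of m "\<lambda>n. (g n)\<^sup>2"] in auto)
  then show ?thesis
    using real_le_rsqrt by (metis power2_abs)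
qed

lemma avg_abs_le:
  fixes f :: "nat \<Rightarrow> real"
  shows "avg m (\<lambda>n. \<bar>f n\<bar>) \<le> sqrt (avg m (\<lambda>n. (f n)\<^sup>2))"
proof (cases "m = 0")
  case False
  then show ?thesis
    using abs_avg_mult_le[of m "\<lambda>n. \<bar>f n\<bar>" "avg m (\<lambda>n. (f n)\<^sup>2)" "\<lambda>_. 1" 1] by (simp add: avg_const)
qed (simp add: avg_def)

text \<open>The residues \<open>n mod P\<close> and \<open>n mod Q\<close> are conditionally independent given
  \<open>n mod gcd P Q\<close>.\<close>

lemma sum_lcm_mod:
  fixes f g :: "nat \<Rightarrow> real"
  assumes "P > 0" "Q > 0"
  defines "d \<equiv> gcd P Q"
  shows "(\<Sum>n<lcm P Q. f (n mod P) * g (n mod Q)) =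
    (\<Sum>r<d. (\<Sum>k<P div d. f (r + d * k)) * (\<Sum>k<Q div d. g (r + d * k)))"
proof -
  \<comment> \<open>Chinese remainder coordinates: the common residue modulo \<open>d\<close>, and
    the quotients by \<open>d\<close> of the residues modulo \<open>P\<close> and
    \<open>Q\<close>.\<close>
  define h where "h = (\<lambda>n. (n mod d, (n mod P) div d, (n mod Q) div d))"
  define T where "T = {..<d} \<times> {..<P div d} \<times> {..<Q div d}"
  have d: "d > 0" "d dvd P" "d dvd Q" using assms by auto
  have P: "d * (P div d) = P" and Q: "d * (Q div d) = Q" using d by auto
  have dP: "n mod d + d * ((n mod P) div d) = n mod P" for n
    using mod_mod_cancel[OF d(2), of n] mod_mult_div_eq[of "n mod P" d] by simp
  have dQ: "n mod d + d * ((n mod Q) div d) = n mod Q" for n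
    using mod_mod_cancel[OF d(3), of n] mod_mult_div_eq[of "n mod Q" d] by simp
  have inj: "inj_on h {..<lcm P Q}"
  proof (rule inj_onI)
    fix x y assume xy: "x \<in> {..<lcm P Q}" "y \<in> {..<lcm P Q}" and h: "h x = h y"
    have "x mod P = fst (h x) + d * fst (snd (h x))" "x mod Q = fst (h x) + d * snd (snd (h x))"
      for x
      unfolding h_def fst_conv snd_conv dP dQ by (rule refl)+
    then have "x mod P = y mod P" "x mod Q = y mod Q" by (simp_all only: h)
    then have "int P dvd int x - int y" "int Q dvd int x - int y"
      by (metis mod_eq_dvd_iff zmod_int)+
    then have "lcm (int P) (int Q) dvd int x - int y" by (rule lcm_least)
    then have "int x mod int (lcm P Q) = int y mod int (lcm P Q)"
      by (simp add: mod_eq_dvd_iff)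
    with xy show "x = y" by (simp flip: zmod_int)
  qed
  have "h ` {..<lcm P Q} = T"
  proof (rule card_subset_eq)
    show "finite T" by (simp add: T_def)
    show "h ` {..<lcm P Q} \<subseteq> T"
      using d assms(1,2) by (auto simp: h_def T_def less_mult_imp_div_less P Q mult.commute)
    \<comment> \<open>The map is already known to be injective, so equal cardinalities suffice; they
      come from gcd times lcm being \<open>P * Q\<close>.\<close>
    have "d * lcm P Q = P * Q" unfolding d_def by (rule prod_gcd_lcm_nat[symmetric])
    also have "\<dots> = d * (d * ((P div d) * (Q div d)))"
      using P Q by (metis mult.assoc mult.left_commute)
    finally have "lcm P Q = card T"
      using d(1) by (simp add: T_def card_cartesian_product)
    then show "card (h ` {..<lcm P Q}) = card T"
      using inj by (simp add: card_image)
  qed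
  then have bij: "bij_betw h {..<lcm P Q} T" using inj by (simp add: bij_betw_def)
  have "(\<Sum>n<lcm P Q. f (n mod P) * g (n mod Q)) =
      (\<Sum>n<lcm P Q. (\<lambda>(r, k, l). f (r + d * k) * g (r + d * l)) (h n))"
    by (simp add: h_def dP dQ)
  also have "\<dots> = (\<Sum>(r, k, l)\<in>T. f (r + d * k) * g (r + d * l))"
    by (rule sum.reindex_bij_betw[OF bij])
  also have "\<dots> = (\<Sum>r<d. (\<Sum>k<P div d. f (r + d * k)) * (\<Sum>k<Q div d. g (r + d * k)))"
    unfolding T_def by (simp add: sum.cartesian_product[symmetric] sum_product)
  finally show ?thesis .
qed

section \<open>Moments of sawtooth functions of residues\<close>

lemma sum_of_nat_lessThan: "(\<Sum>k<n. real k) = real n * (real n - 1) / 2"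
  by (induction n) (auto simp: field_simps)

lemma sum_saw_squares: "d > 0 \<Longrightarrow> (\<Sum>r<d. (real r / real d - 1/2)\<^sup>2) = ((real d)\<^sup>2
  + 2) / (12 * real d)"
proof -
  \<comment> \<open>A centre \<open>c\<close> that is not tied to the upper limit \<open>n\<close>
    is what the induction can carry; both are set to \<open>d\<close> afterwards.\<close>
  have *: "(\<Sum>r<n. (2 * real r - c)\<^sup>2) = (2 * real n * (real n - 1) * (2 * real n - 1) / 3
      - 2 * c * real n * (real n - 1) + c\<^sup>2 * real n)" for n c
  proof (induction n)
    case (Suc n)
    then show ?case unfolding sum.lessThan_Suc Suc by (simp add: field_simps power2_eq_square)
  qed simp
  assume "d > 0"
  then have "(\<Sum>r<d. (real r / real d - 1/2)\<^sup>2) = (\<Sum>r<d. (2 * real r - real d)\<^sup>2) / (2 * real d)\<^sup>2"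
    unfolding sum_divide_distrib by (intro sum.cong refl) (simp add: field_simps power2_eq_square)
  also have "\<dots> = ((real d)\<^sup>2 + 2) / (12 * real d)"
    using \<open>d > 0\<close> unfolding * by (simp add: field_simps power2_eq_square)
  finally show ?thesis .
qed

text \<open>The product has period \<open>lcm P Q\<close>. Summing a sawtooth of modulus
  \<open>m\<close> over one residue class modulo a divisor \<open>d\<close> gives the sawtooth of
  modulus \<open>d\<close> (the step \<open>inner\<close>), so conditional independence given the
  residue modulo the gcd leaves a sum of squares of one sawtooth.\<close>

lemma avg_saw_saw:
  assumes "P > 0" "Q > 0" "M > 0" "P dvd M" "Q dvd M"
  shows "avg M (\<lambda>n. (real (n mod P) / real P - 1/2) * (real (n mod Q) / real Q - 1/2)) =
    ((real (gcd P Q))\<^sup>2 + 2) / (12 * real P * real Q)"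
proof -
  define d where "d = gcd P Q"
  define L where "L = lcm P Q"
  define f where "f P x = real x / real P - 1/2" for P x
  have d: "d > 0" "d dvd P" "d dvd Q" using assms by (auto simp: d_def)
  have inner: "(\<Sum>k<m div d. f m (r + d * k)) = f d r" if m: "d dvd m" "m > 0" for m r
  proof -
    obtain e where e: "m = d * e" using m by blast
    with m d have "e > 0" by auto
    then show ?thesis using d(1)
      by (simp add: f_def e sum_subtractf sum.distrib add_divide_distrib
        sum_divide_distrib[symmetric]
        sum_of_nat_lessThan sum_distrib_left[symmetric]) (simp add: field_simps)
  qed
  have "avg M (\<lambda>n. f P (n mod P) * f Q (n mod Q))
    = avg M (\<lambda>n. f P (n mod L mod P) * f Q (n mod L mod Q))"
    by (intro avg_cong) (simp add: L_def mod_mod_cancel)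
  also have "\<dots> = avg L (\<lambda>n. f P (n mod P) * f Q (n mod Q))"
    using assms by (intro avg_mod) (auto simp: L_def)
  also have "\<dots> = (\<Sum>r<d. (f d r)\<^sup>2) / real L"
    unfolding avg_def L_def sum_lcm_mod[OF assms(1,2)]
    by (simp add: d_def[symmetric] inner d assms power2_eq_square divide_inverse)
  also have "\<dots> = ((real d)\<^sup>2 + 2) / (12 * (real d * real L))"
    using sum_saw_squares[OF d(1)] by (simp add: f_def)
  also have "real d * real L = real P * real Q"
    unfolding d_def L_def by (metis of_nat_mult prod_gcd_lcm_nat)
  finally show ?thesis by (simp add: f_def d_def mult.assoc)
qed

text \<open>Centring by \<open>1/2\<close> instead of the exact mean leaves this defect. It is
  summable over moduli that grow geometrically.\<close>

lemma avg_saw: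
  assumes "P > 0" "M > 0" "P dvd M"
  shows "avg M (\<lambda>n. real (n mod P) / real P - 1/2) = - 1 / (2 * real P)"
proof -
  have "avg M (\<lambda>n. real (n mod P) / real P - 1/2) = avg P (\<lambda>n. real n / real P - 1/2)"
    by (rule avg_mod) (use assms in auto)
  also have "\<dots> = - 1 / (2 * real P)"
    using assms(1) by (simp add: avg_def sum_subtractf sum_divide_distrib[symmetric]
      sum_of_nat_lessThan) (simp add: field_simps)
  finally show ?thesis .
qed

lemma frac_of_nat_divide: "m > 0 \<Longrightarrow> frac (real n / real m) = real (n mod m) / real m"
  by (simp add: frac_def floor_divide_of_nat_eq field_simps)
    (metis add.commute mod_mult_div_eq mult.commute of_nat_add of_nat_mult)

text \<open>The fractional part moves by only \<open>a * u / m\<close>, unless the residue of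
  \<open>a * n\<close> is within \<open>a\<close> of wrapping around. At most \<open>a\<close>
  values of \<open>n\<close> are of that kind (the set \<open>B\<close>), each costing at most 1.
  The decay in \<open>m\<close> is what makes the sum over the scales \<open>m = q ^ l\<close>
  converge.\<close>

lemma frac_shift_square_avg_le:
  fixes a m :: nat and u :: real
  assumes a: "a > 0" and m: "m > 0" and u: "0 \<le> u" "u < 1"
  shows "avg m (\<lambda>n. (frac (real a * (real n + u) / real m) - frac (real a * real n / real m))\<^sup>2)
    \<le> 2 * (real a)\<^sup>2 / real m"
proof -
  define B where "B = {n. n < m \<and> m < a * n mod m + a}"
  define e where "e n = frac (real a * (real n + u) / real m) - frac (real a * real n / real m)"
    for n
  have e_le: "(e n)\<^sup>2 \<le> (real a)\<^sup>2 / (real m)\<^sup>2 + indicator B n" if "n < m" for n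
  proof (cases "n \<in> B")
    case True
    have "\<bar>e n\<bar> \<le> 1"
      using frac_lt_1[of "real a * (real n + u) / real m"] frac_lt_1[of "real a * real n / real m"]
        frac_ge_0[of "real a * (real n + u) / real m"] frac_ge_0[of "real a * real n / real m"]
      unfolding e_def abs_le_iff by linarith
    then have "(e n)\<^sup>2 \<le> 1" by (simp add: abs_square_le_1)
    then show ?thesis using True by (simp add: add_increasing)
  next
    case False
    define r where "r = a * n mod m"
    have au: "0 \<le> real a * u" "real a * u < real a" using a u by auto
    have "r + a \<le> m" using False that by (auto simp: B_def r_def)
    then have "real r + real a \<le> real m" by linarith
    then have bnd: "0 \<le> (real r + real a * u) / real m" "(real r + real a * u) / real m < 1"
      using au m by (auto simp: divide_simps)
    have "a * n = m * (a * n div m) + r" by (simp add: r_def)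
    then have "real a * real n = real m * real (a * n div m) + real r"
      by (metis of_nat_add of_nat_mult)
    then have eq: "real a * (real n + u) / real m = (real r + real a * u) / real m
      + of_int (int (a * n div m))"
      using m by (simp add: field_simps)
    have "frac (real a * (real n + u) / real m) = (real r + real a * u) / real m"
      unfolding eq frac_add_of_int_right using bnd by (simp add: frac_eq)
    moreover have "frac (real a * real n / real m) = real r / real m"
      using frac_of_nat_divide[OF m, of "a * n"] by (simp add: r_def)
    ultimately have "e n = real a * u / real m" by (simp add: e_def add_divide_distrib)
    then have "\<bar>e n\<bar> \<le> real a / real m" using au
      by (simp add: divide_right_mono less_imp_le del: mult_nonneg_nonneg)
    then have "(e n)\<^sup>2 \<le> (real a / real m)\<^sup>2"
      by (metis abs_le_square_iff abs_of_nonneg divide_nonneg_nonneg of_nat_0_le_iff)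
    then show ?thesis using False by (simp add: power_divide)
  qed
  have "card B \<le> card {..<a}"
  proof (rule card_inj_on_le)
    show "(\<lambda>n. a * n div m) ` B \<subseteq> {..<a}"
      using a by (auto simp: B_def less_mult_imp_div_less)
    \<comment> \<open>From \<open>x\<close> to a later \<open>y\<close> the product
      \<open>a * n\<close> grows by at least \<open>a\<close>, which from a member of
      \<open>B\<close> overshoots the next multiple of \<open>m\<close>; so the quotient must
      change.\<close>
    have *: False if "x \<in> B" "y \<in> B" "x < y" "a * x div m = a * y div m" for x y
    proof -
      have "a * x + a \<le> a * y" using that(3) by (metis Suc_leI mult_Suc_right mult_le_mono2
        add.commute)
      moreover have "a * x = m * (a * x div m) + a * x mod m" "a * y = m * (a * x div m)
        + a * y mod m"
        unfolding that(4) by (metis that(4) mult_div_mod_eq)+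
      moreover have "a * y mod m < m" using m by simp
      moreover have "m < a * x mod m + a" using that(1) by (simp add: B_def)
      ultimately show False by linarith
    qed
    then show "inj_on (\<lambda>n. a * n div m) B"
      by (intro inj_onI) (metis linorder_neqE_nat)
  qed simp
  then have cB: "real (card B) \<le> real a" by simp
  have "(\<Sum>n<m. (e n)\<^sup>2) \<le> (\<Sum>n<m. (real a)\<^sup>2 / (real m)\<^sup>2 + indicator B n)"
    by (intro sum_mono e_le) auto
  also have "\<dots> = (real a)\<^sup>2 / real m + (\<Sum>n<m. indicator B n)"
    by (simp add: sum.distrib power2_eq_square)
  also have "(\<Sum>n<m. indicator B n) = real (card B)"
  proof -
    have "{..<m} \<inter> {n. n \<in> B} = B" by (auto simp: B_def)
    then show ?thesis by (simp add: indicator_def[abs_def] sum.If_cases)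
  qed
  also have "(real a)\<^sup>2 / real m + real (card B) \<le> (real a)\<^sup>2 + (real a)\<^sup>2"
  proof (rule add_mono)
    show "(real a)\<^sup>2 / real m \<le> (real a)\<^sup>2" using m by (simp add: divide_le_eq mult_le_cancel_left1)
    have "real a \<le> (real a)\<^sup>2" using a by (simp add: self_le_power)
    with cB show "real (card B) \<le> (real a)\<^sup>2" by linarith
  qed
  finally have "(\<Sum>n<m. (e n)\<^sup>2) / real m \<le> 2 * (real a)\<^sup>2 / real m"
    by (intro divide_right_mono) auto
  then show ?thesis by (simp add: avg_def e_def divide_inverse mult.commute)
qed

lemma sum_power_le:
  fixes x :: real
  assumes "0 \<le> x" "x < 1"
  shows "(\<Sum>l=1..b. x ^ l) \<le> x / (1 - x)"
proof -
  have "(1 - x) * (\<Sum>l=1..b. x ^ l) = x - x ^ Suc b"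
  proof (induction b)
    case (Suc b)
    have "(1 - x) * (\<Sum>l=1..Suc b. x ^ l) = (1 - x) * (\<Sum>l=1..b. x ^ l) + (1 - x) * x ^ Suc b"
      by (simp add: distrib_left)
    also have "\<dots> = x - x ^ Suc (Suc b)" unfolding Suc by (simp add: algebra_simps)
    finally show ?case .
  qed simp
  also have "\<dots> \<le> x" using assms by simp
  finally show ?thesis using assms by (simp add: field_simps)
qed

section \<open>Cesaro means\<close>

lemma Cesaro_limit:
  fixes X :: "nat \<Rightarrow> real"
  assumes X: "X \<longlonglongrightarrow> L"
  shows "(\<lambda>n. (\<Sum>k<n. X k) / real n) \<longlonglongrightarrow> L"
proof (rule LIMSEQ_I)
  fix r :: real assume r: "r > 0"
  obtain N where N: "\<And>n. n \<ge> N \<Longrightarrow> norm (X n - L) < r / 2"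
    using LIMSEQ_D[OF X, of "r/2"] r by auto
  define c where "c = (\<Sum>k<N. \<bar>X k - L\<bar>)"
  obtain M where M: "2 * c / r < real M" using reals_Archimedean2 by blast
  show "\<exists>no. \<forall>n\<ge>no. norm ((\<Sum>k<n. X k) / real n - L) < r"
  proof (intro exI allI impI)
    fix n assume n: "n \<ge> max 1 (max N M)"
    have "(\<Sum>k<n. X k) / real n - L = (\<Sum>k<n. X k - L) / real n"
      using n by (simp add: sum_subtractf field_simps)
    also have "\<bar>\<dots>\<bar> \<le> (\<Sum>k<n. \<bar>X k - L\<bar>) / real n"
      using n by (simp add: divide_right_mono)
    also have "(\<Sum>k<n. \<bar>X k - L\<bar>) = c + (\<Sum>k=N..<n. \<bar>X k - L\<bar>)"
      using n sum.atLeastLessThan_concat[of 0 N n "\<lambda>k. \<bar>X k - L\<bar>"]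
      by (simp add: c_def atLeast0LessThan)
    also have "(\<Sum>k=N..<n. \<bar>X k - L\<bar>) \<le> (\<Sum>k=N..<n. r / 2)"
      using N by (intro sum_mono) (auto intro: less_imp_le)
    also have "(\<Sum>k=N..<n. r / 2) \<le> real n * (r / 2)"
      using r by (simp add: mult_right_mono)
    finally have "\<bar>(\<Sum>k<n. X k) / real n - L\<bar> \<le> (c + real n * (r / 2)) / real n"
      by (simp add: divide_right_mono)
    also have "\<dots> < r"
    proof -
      have "2 * c < r * real M" using M r by (simp add: field_simps)
      also have "\<dots> \<le> r * real n" using n r by simp
      finally show ?thesis using n by (simp add: field_simps)
    qed
    finally show "norm ((\<Sum>k<n. X k) / real n - L) < r" by simp
  qed
qed

text \<open>Enlarging the square from \<open>n\<close> to \<open>n + 1\<close> adds one row and one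
  column, whose total \<open>X n\<close> is a partial sum of both series. The double sum is
  therefore a sum of convergent terms. The \<open>Suc\<close> in the second series keeps the
  diagonal from being counted twice.\<close>

lemma double_sum_Cesaro_limit:
  fixes \<kappa> \<kappa>' :: "nat \<Rightarrow> real"
  assumes \<kappa>: "\<kappa> sums a" and \<kappa>': "(\<lambda>d. \<kappa>' (Suc d)) sums b"
  shows "(\<lambda>n. (\<Sum>l<n. \<Sum>m<n. if l \<le> m then \<kappa> (m - l) else \<kappa>' (l - m)) / real n) \<longlonglongrightarrow> a + b"
proof -
  define x where "x l m = (if l \<le> m then \<kappa> (m - l) else \<kappa>' (l - m))" for l m :: nat
  define X where "X n = (\<Sum>d<Suc n. \<kappa> d) + (\<Sum>d<n. \<kappa>' (Suc d))" for n
  have "(\<Sum>l<n. \<Sum>m<n. x l m) = (\<Sum>k<n. X k)" for n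
  proof (induction n)
    case (Suc n)
    have "(\<Sum>l<Suc n. \<Sum>m<Suc n. x l m) = (\<Sum>l<n. \<Sum>m<n. x l m) + ((\<Sum>l<Suc n. x l n) + (\<Sum>m<n. x n m))"
      by (simp add: sum.distrib)
    also have "(\<Sum>l<Suc n. x l n) = (\<Sum>l<Suc n. \<kappa> (Suc n - Suc l))"
      by (intro sum.cong) (auto simp: x_def)
    also have "\<dots> = (\<Sum>d<Suc n. \<kappa> d)" by (rule sum.nat_diff_reindex)
    also have "(\<Sum>m<n. x n m) = (\<Sum>m<n. \<kappa>' (Suc (n - Suc m)))"
      by (intro sum.cong) (auto simp: x_def Suc_diff_Suc)
    also have "\<dots> = (\<Sum>d<n. \<kappa>' (Suc d))" by (rule sum.nat_diff_reindex)
    finally show ?case by (simp add: Suc X_def)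
  qed simp
  moreover have "X \<longlonglongrightarrow> a + b"
    unfolding X_def using \<kappa> \<kappa>' unfolding sums_def by (intro tendsto_add) (auto dest: LIMSEQ_Suc)
  ultimately show ?thesis
    using Cesaro_limit[of X "a + b"] by (simp add: x_def)
qed

section \<open>Sums over independent digit blocks\<close>

text \<open>\<open>Y\<close> is summed over the \<open>k\<close> lowest base-\<open>Q\<close> digits
  of \<open>n\<close>. With \<open>Q = q ^ p\<close> such a digit is a block of \<open>p\<close>
  base-\<open>q\<close> digits, and for uniform \<open>n < Q ^ k\<close> these digits are
  independent and uniform.\<close>

primrec block_sum :: "(nat \<Rightarrow> real) \<Rightarrow> nat \<Rightarrow> nat \<Rightarrow> nat \<Rightarrow> real" where
  "block_sum Y Q 0 n = 0"
| "block_sum Y Q (Suc k) n = Y (n mod Q) + block_sum Y Q k (n div Q)"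

lemma avg_power_Suc: "avg (Q ^ Suc k) f = avg Q (\<lambda>x. avg (Q ^ k) (\<lambda>y. f (x + Q * y)))"
  by (simp add: avg_lessThan_mult)

lemma block_sum_Suc: "x < Q \<Longrightarrow> block_sum Y Q (Suc k) (x + Q * y) = Y x + block_sum Y Q k y"
  by simp

lemma avg_block_sum:
  assumes "Q > 0" "avg Q Y = 0"
  shows "avg (Q ^ k) (block_sum Y Q k) = 0"
proof (induction k)
  case (Suc k)
  have "avg (Q ^ Suc k) (block_sum Y Q (Suc k)) = avg Q (\<lambda>x. avg (Q ^ k) (\<lambda>y. Y x
    + block_sum Y Q k y))"
    unfolding avg_power_Suc by (intro avg_cong block_sum_Suc)
  also have "\<dots> = 0"
    using assms by (simp add: avg_add avg_const Suc)
  finally show ?case .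
qed (simp add: avg_def)

text \<open>The lowest digit is independent of the others and \<open>Y\<close> has mean zero, so the
  cross term vanishes and variances add.\<close>

lemma avg_block_sum_square:
  assumes "Q > 0" "avg Q Y = 0"
  shows "avg (Q ^ k) (\<lambda>n. (block_sum Y Q k n)\<^sup>2) = real k * avg Q (\<lambda>n. (Y n)\<^sup>2)"
proof (induction k)
  case (Suc k)
  have "avg (Q ^ Suc k) (\<lambda>n. (block_sum Y Q (Suc k) n)\<^sup>2) =
      avg Q (\<lambda>x. avg (Q ^ k) (\<lambda>y. (Y x)\<^sup>2 + (2 * Y x * block_sum Y Q k y + (block_sum Y Q k y)\<^sup>2)))"
    unfolding avg_power_Suc
    by (intro avg_cong) (simp only: block_sum_Suc power2_sum add.assoc add.commute add.left_commute)
  also have "\<dots> = avg Q (\<lambda>x. (Y x)\<^sup>2 + real k * avg Q (\<lambda>n. (Y n)\<^sup>2))"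
    using assms by (simp add: avg_add avg_const avg_mult_left Suc avg_block_sum)
  also have "\<dots> = real (Suc k) * avg Q (\<lambda>n. (Y n)\<^sup>2)"
    using assms by (simp add: avg_add avg_const algebra_simps)
  finally show ?case .
qed (simp add: avg_def)

lemma avg_cis_block_sum:
  assumes "Q > 0"
  shows "avg (Q ^ k) (\<lambda>n. cis (s * block_sum Y Q k n)) = avg Q (\<lambda>n. cis (s * Y n)) ^ k"
proof (induction k)
  case (Suc k)
  have "avg (Q ^ Suc k) (\<lambda>n. cis (s * block_sum Y Q (Suc k) n)) =
      avg Q (\<lambda>x. avg (Q ^ k) (\<lambda>y. cis (s * Y x) * cis (s * block_sum Y Q k y)))"
    unfolding avg_power_Suc
    by (intro avg_cong) (simp only: block_sum_Suc cis_mult distrib_left)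
  also have "\<dots> = avg Q (\<lambda>x. cis (s * Y x)) ^ Suc k"
    by (simp add: avg_mult_left avg_mult_right Suc)
  finally show ?case .
qed (simp add: avg_def)

section \<open>Estimates of characteristic functions\<close>

lemma cmod_cis_diff_le: "cmod (cis a - cis b) \<le> \<bar>a - b\<bar>"
proof -
  have "cis a - cis b = cis b * (cis (a - b) - 1)" by (simp add: algebra_simps cis_mult)
  then have "cmod (cis a - cis b) = cmod (cis (a - b) - 1)" by (simp add: norm_mult)
  also have "\<dots> \<le> \<bar>a - b\<bar>" using iexp_approx1[of "a - b" 0] by (simp add: cis_conv_exp)
  finally show ?thesis .
qed

text \<open>\<open>cis\<close> is 1-Lipschitz and the mean absolute value is at most the root mean
  square. This converts every mean-square approximation below into closeness of characteristic
  functions.\<close>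

lemma cmod_avg_cis_diff_le:
  "cmod (avg m (\<lambda>n. cis (s * f n)) - avg m (\<lambda>n. cis (s * g n))) \<le> \<bar>s\<bar> * sqrt (avg m (\<lambda>n. (f n
    - g n)\<^sup>2))"
proof -
  have "cmod (avg m (\<lambda>n. cis (s * f n)) - avg m (\<lambda>n. cis (s * g n)))
    \<le> avg m (\<lambda>n. cmod (cis (s * f n) - cis (s * g n)))"
    unfolding avg_diff[symmetric] by (rule norm_avg_le)
  also have "\<dots> \<le> avg m (\<lambda>n. \<bar>s\<bar> * \<bar>f n - g n\<bar>)"
    by (intro avg_mono order_trans[OF cmod_cis_diff_le]) (simp flip: abs_mult right_diff_distrib)
  also have "\<dots> \<le> \<bar>s\<bar> * sqrt (avg m (\<lambda>n. (f n - g n)\<^sup>2))"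
    unfolding avg_mult_left by (intro mult_left_mono avg_abs_le) simp
  finally show ?thesis .
qed

lemma cmod_avg_cis_le_1: "cmod (avg m (\<lambda>n. cis (f n))) \<le> 1"
  by (rule order_trans[OF norm_avg_le]) (cases "m = 0"; simp add: avg_const; simp add: avg_def)

text \<open>In the second-order Taylor expansion the linear term vanishes by \<open>mean\<close>,
  and the cubic remainder gives \<open>B ^ 3\<close>. The term \<open>v\<^sup>2\<close> covers the
  gap between \<open>1 - z\<close> and \<open>exp (- z)\<close>, where the bound on \<open>s\<close>
  lets a fourth power be replaced by a third.\<close>

lemma avg_cis_Taylor:
  fixes Y :: "nat \<Rightarrow> real"
  assumes Q: "Q > 0" and mean: "avg Q Y = 0" and bnd: "\<And>n. n < Q \<Longrightarrow> \<bar>Y n\<bar> \<le> B"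
    and s: "\<bar>s\<bar> \<le> 1"
  defines "v \<equiv> avg Q (\<lambda>n. (Y n)\<^sup>2)"
  shows "cmod (avg Q (\<lambda>n. cis (s * Y n)) - exp (- (v * s\<^sup>2 / 2))) \<le> (B ^ 3 + v\<^sup>2) * \<bar>s\<bar> ^ 3"
proof -
  have v0: "v \<ge> 0" unfolding v_def by (rule avg_nonneg) simp
  define z where "z = v * s\<^sup>2 / 2"
  have z0: "z \<ge> 0" using v0 by (simp add: z_def)
  define p where "p n = (1 + \<i> * of_real (s * Y n) - of_real ((s * Y n)\<^sup>2 / 2))" for n
  have "cmod (cis (s * Y n) - p n) \<le> B ^ 3 * \<bar>s\<bar> ^ 3" if "n < Q" for n
  proof -
    have "{..2::nat} = {0, 1, 2}" by auto
    then have "cmod (cis (s * Y n) - p n) \<le> \<bar>s * Y n\<bar> ^ 3 / 6"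
      using iexp_approx1[of "s * Y n" 2]
      by (simp add: p_def cis_conv_exp eval_nat_numeral power2_eq_square algebra_simps)
    also have "\<dots> \<le> \<bar>s * Y n\<bar> ^ 3" by simp
    also have "\<dots> = \<bar>Y n\<bar> ^ 3 * \<bar>s\<bar> ^ 3" by (simp add: abs_mult power_mult_distrib)
    also have "\<dots> \<le> B ^ 3 * \<bar>s\<bar> ^ 3" using bnd[OF that] by (intro mult_right_mono power_mono) auto
    finally show ?thesis .
  qed
  then have "avg Q (\<lambda>n. cmod (cis (s * Y n) - p n)) \<le> B ^ 3 * \<bar>s\<bar> ^ 3"
    by (rule avg_le_const[OF Q])
  then have 1: "cmod (avg Q (\<lambda>n. cis (s * Y n)) - avg Q p) \<le> B ^ 3 * \<bar>s\<bar> ^ 3"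
    unfolding avg_diff[symmetric] by (rule order_trans[OF norm_avg_le])
  have "avg Q (\<lambda>n. complex_of_real (f n)) = of_real (avg Q f)" for f
    by (simp add: avg_def scaleR_conv_of_real)
  moreover have "p = (\<lambda>n. 1 + \<i> * of_real (s * Y n) - of_real (s\<^sup>2 / 2 * (Y n)\<^sup>2))"
    by (simp add: p_def[abs_def] power_mult_distrib)
  ultimately have "avg Q p = 1 + \<i> * of_real (avg Q (\<lambda>n. s * Y n))
    - of_real (avg Q (\<lambda>n. s\<^sup>2 / 2 * (Y n)\<^sup>2))"
    by (simp only: avg_diff avg_add avg_mult_left[of _ \<i>] avg_const[OF Q])
  also have "\<dots> = of_real (1 - z)"
    unfolding avg_mult_left mean by (simp add: z_def v_def)
  finally have p: "avg Q p = of_real (1 - z)" .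
  \<comment> \<open>The inequality \<open>1 + x \<le> exp x\<close>, taken at \<open>z\<close> and
    at \<open>- z\<close>, squeezes \<open>exp (- z)\<close> between \<open>1 - z\<close> and
    \<open>1 - z + z\<^sup>2\<close>.\<close>
  have "exp (- z) \<le> 1 / (1 + z)"
    using exp_ge_add_one_self[of z] z0 by (simp add: exp_minus field_simps)
  also have "\<dots> \<le> 1 - z + z\<^sup>2"
    using z0 by (simp add: field_simps power2_eq_square)
  finally have "exp (- z) - (1 - z) \<le> z\<^sup>2" by simp
  moreover have "1 - z \<le> exp (- z)" using exp_ge_add_one_self[of "- z"] by simp
  ultimately have "\<bar>(1 - z) - exp (- z)\<bar> \<le> z\<^sup>2" by linarith
  also have "z\<^sup>2 \<le> v\<^sup>2 * \<bar>s\<bar> ^ 3"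
  proof -
    have "z\<^sup>2 = v\<^sup>2 * \<bar>s\<bar> ^ 3 * \<bar>s\<bar> / 4"
      by (simp add: z_def power2_eq_square power3_eq_cube abs_if)
    also have "\<dots> \<le> v\<^sup>2 * \<bar>s\<bar> ^ 3 * 1 / 4" using s by (intro divide_right_mono mult_left_mono) auto
    also have "\<dots> \<le> v\<^sup>2 * \<bar>s\<bar> ^ 3" by simp
    finally show ?thesis .
  qed
  finally have "cmod (avg Q p - exp (- z)) \<le> v\<^sup>2 * \<bar>s\<bar> ^ 3"
    unfolding p by (metis norm_of_real of_real_diff of_real_exp)
  with 1 have "cmod (avg Q (\<lambda>n. cis (s * Y n)) - exp (- z)) \<le> B ^ 3 * \<bar>s\<bar> ^ 3 + v\<^sup>2 * \<bar>s\<bar> ^ 3"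
    using norm_triangle_ineq[of "avg Q (\<lambda>n. cis (s * Y n)) - avg Q p" "avg Q p - exp (- z)"] by simp
  then show ?thesis by (simp add: z_def distrib_right)
qed

text \<open>The \<open>k\<close>-th powers of two numbers in the closed unit disc differ by at most
  \<open>k\<close> times the distance of the numbers, so the one-block error is multiplied by at
  most \<open>k\<close>. For \<open>s\<close> of order \<open>1 / sqrt k\<close> the bound is again
  of order \<open>1 / sqrt k\<close>.\<close>

lemma cmod_avg_cis_block_sum_le:
  fixes Y :: "nat \<Rightarrow> real"
  assumes Q: "Q > 0" and mean: "avg Q Y = 0" and bnd: "\<And>n. n < Q \<Longrightarrow> \<bar>Y n\<bar> \<le> B"
    and s: "\<bar>s\<bar> \<le> 1"
  defines "v \<equiv> avg Q (\<lambda>n. (Y n)\<^sup>2)"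
  shows "cmod (avg (Q ^ k) (\<lambda>n. cis (s * block_sum Y Q k n)) - exp (- (v * (real k * s\<^sup>2) / 2)))
    \<le> real k * ((B ^ 3 + v\<^sup>2) * \<bar>s\<bar> ^ 3)"
proof -
  have v0: "v \<ge> 0" unfolding v_def by (rule avg_nonneg) simp
  have e: "complex_of_real (exp (- (v * (real k * s\<^sup>2) / 2)))
    = complex_of_real (exp (- (v * s\<^sup>2 / 2))) ^ k"
    by (simp flip: of_real_power exp_of_nat_mult add: ac_simps)
  have "cmod (avg Q (\<lambda>n. cis (s * Y n)) ^ k - complex_of_real (exp (- (v * s\<^sup>2 / 2))) ^ k) \<le>
     real k * cmod (avg Q (\<lambda>n. cis (s * Y n)) - complex_of_real (exp (- (v * s\<^sup>2 / 2))))"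
    using v0 by (intro norm_power_diff cmod_avg_cis_le_1) simp
  also have "\<dots> \<le> real k * ((B ^ 3 + v\<^sup>2) * \<bar>s\<bar> ^ 3)"
    using avg_cis_Taylor[OF Q mean bnd s] by (intro mult_left_mono) (auto simp: v_def)
  finally show ?thesis unfolding avg_cis_block_sum[OF Q] e .
qed

section \<open>Digit sums as sums of fractional parts\<close>

lemma digit_sum_eq_lessThan:
  assumes "q \<ge> 2" "m < q ^ J"
  shows "digit_sum q m = (\<Sum>l<J. digit q l m)"
  unfolding digit_sum_def
proof (rule sum.mono_neutral_left)
  show "{l. digit q l m \<noteq> 0} \<subseteq> {..<J}"
  proof
    fix l assume l: "l \<in> {l. digit q l m \<noteq> 0}"
    show "l \<in> {..<J}"
    proof (rule ccontr)
      assume "l \<notin> {..<J}"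
      then have "q ^ J \<le> q ^ l" using assms(1) by (intro power_increasing) auto
      with assms(2) have "m div q ^ l = 0" by simp
      with l show False by (simp add: digit_def)
    qed
  qed
qed auto

text \<open>Finite form of Legendre's formula: \<open>q\<close> times the fractional part of
  \<open>m / q ^ Suc M\<close> is digit \<open>M\<close> plus the fractional part of
  \<open>m / q ^ M\<close>. The last fractional part is the boundary term of this recursion.\<close>

lemma sum_digit_eq_frac:
  assumes "q \<ge> 2"
  shows "real (\<Sum>l<M. digit q l m) = (real q - 1) * (\<Sum>l=1..M. frac (real m / real q ^ l))
    + frac (real m / real q ^ M)"
proof (induction M)
  case (Suc M)
  have fr: "frac (real m / real q ^ l) = real (m mod q ^ l) / real q ^ l" for l
    using frac_of_nat_divide[of "q ^ l" m] assms by simp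
  have "m mod q ^ Suc M = q ^ M * digit q M m + m mod q ^ M"
    unfolding digit_def power_Suc2 by (rule mod_mult2_eq)
  then have "real (m mod q ^ Suc M) = real q ^ M * real (digit q M m) + real (m mod q ^ M)"
    by (metis of_nat_add of_nat_mult of_nat_power)
  then have "real q * frac (real m / real q ^ Suc M) = real (digit q M m)
    + frac (real m / real q ^ M)"
    unfolding fr using assms by (simp add: field_simps)
  then show ?case using Suc by (simp add: algebra_simps)
qed simp

text \<open>The \<open>M\<close> lowest digits are captured up to a boundary term below 1, and each
  of the at most \<open>B\<close> remaining digits is below \<open>q\<close>.\<close>

lemma abs_digit_sum_minus_frac_le:
  assumes q: "q \<ge> 2" and m: "m < q ^ (M + B)"
  shows "\<bar>real (digit_sum q m) - (real q - 1) * (\<Sum>l=1..M. frac (real m / real q ^ l))\<bar> \<le> 1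
    + real q * real B"
proof -
  have "digit_sum q m = (\<Sum>l<M. digit q l m) + (\<Sum>l=M..<M+B. digit q l m)"
    unfolding digit_sum_eq_lessThan[OF q m]
    using sum.atLeastLessThan_concat[of 0 M "M+B" "\<lambda>l. digit q l m"] by (simp add: atLeast0LessThan)
  moreover have "(\<Sum>l=M..<M+B. digit q l m) \<le> (\<Sum>l=M..<M+B. q)"
    using q by (intro sum_mono) (simp add: digit_def less_imp_le)
  ultimately have "real (digit_sum q m) \<ge> real (\<Sum>l<M. digit q l m)"
    "real (digit_sum q m) \<le> real (\<Sum>l<M. digit q l m) + real q * real B"
    by (auto simp flip: of_nat_mult of_nat_add of_nat_sum simp: mult.commute)
  then show ?thesis
    unfolding sum_digit_eq_frac[OF q]
    using frac_lt_1[of "real m / real q ^ M"] frac_ge_0[of "real m / real q ^ M"] by linarith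
qed

text \<open>Complete periods reproduce the average exactly; only the incomplete last period, of
  fewer than \<open>m\<close> terms, contributes an error. With \<open>m\<close> a power of
  \<open>q\<close> this replaces uniform \<open>n < N\<close> by uniform low digits.\<close>

lemma cmod_avg_mod_diff_le:
  fixes h :: "nat \<Rightarrow> complex"
  assumes m: "m > 0" and N: "N > 0" and h: "\<And>n. cmod (h n) \<le> 1"
  shows "cmod (avg N (\<lambda>n. h (n mod m)) - avg m h) \<le> 2 * real m / real N"
proof -
  define a r where "a = N div m" and "r = N mod m"
  have Nr: "N = m * a + r" by (simp add: a_def r_def)
  have r: "r < m" using m by (simp add: r_def)
  define e where "e = (\<Sum>x<r. h x)"
  have "(\<Sum>n<N. h (n mod m)) = (\<Sum>n<m*a. h (n mod m)) + (\<Sum>n=m*a..<m*a+r. h (n mod m))"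
    unfolding Nr using sum.atLeastLessThan_concat[of 0 "m*a" "m*a+r" "\<lambda>n. h (n mod m)"]
    by (simp add: atLeast0LessThan)
  also have "(\<Sum>n<m*a. h (n mod m)) = of_nat a * (\<Sum>x<m. h x)"
    unfolding sum_lessThan_mult by (simp add: sum_distrib_left)
  also have "(\<Sum>n=m*a..<m*a+r. h (n mod m)) = (\<Sum>x<r. h ((x + m * a) mod m))"
    using sum.shift_bounds_nat_ivl[of "\<lambda>n. h (n mod m)" 0 "m*a" r]
    by (simp add: atLeast0LessThan add.commute)
  also have "\<dots> = e" unfolding e_def using r by (intro sum.cong) auto
  also have "(\<Sum>x<m. h x) = of_nat m * avg m h"
    using m by (simp add: avg_def scaleR_conv_of_real)
  finally have "(\<Sum>n<N. h (n mod m)) = of_nat a * (of_nat m * avg m h) + e" .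
  moreover have "of_nat N * avg N (\<lambda>n. h (n mod m)) = (\<Sum>n<N. h (n mod m))"
    using N by (simp add: avg_def scaleR_conv_of_real)
  ultimately have "of_nat N * (avg N (\<lambda>n. h (n mod m)) - avg m h) = of_nat (m * a) * avg m h + e
    - of_nat N * avg m h"
    by (simp add: right_diff_distrib)
  also have "\<dots> = e - of_nat r * avg m h"
    by (simp add: Nr algebra_simps)
  finally have "cmod (of_nat N * (avg N (\<lambda>n. h (n mod m)) - avg m h)) \<le> cmod e
    + cmod (of_nat r * avg m h)"
    by (simp add: norm_triangle_ineq4)
  also have "cmod e \<le> real r" unfolding e_def
    by (rule order_trans[OF norm_sum]) (use sum_mono[of "{..<r}" "\<lambda>x. cmod (h x)" "\<lambda>_. 1"] h in
      auto)
  also have "cmod (of_nat r * avg m h) \<le> real r * 1"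
    unfolding norm_mult norm_of_nat
    by (intro mult_left_mono order_trans[OF norm_avg_le] avg_le_const m h) auto
  also have "real r + real r * 1 \<le> 2 * real m" using r by simp
  finally have "real N * cmod (avg N (\<lambda>n. h (n mod m)) - avg m h) \<le> 2 * real m"
    by (simp only: norm_mult norm_of_nat)
  then show ?thesis using N by (simp add: field_simps)
qed

section \<open>Sawtooth sums\<close>

locale multiplied_digits =
  fixes q :: nat and A :: "'d::finite \<Rightarrow> nat"
  assumes q_ge_2: "q \<ge> 2" and A_pos: "\<And>i. A i > 0"
begin

text \<open>The argument is real because the functional is also evaluated at perturbed points
  \<open>n + u\<close>. The centring by \<open>1/2\<close> accounts for the mean
  \<open>(q - 1) / 2\<close> per digit.\<close>

definition saw_sum :: "('d \<Rightarrow> real) \<Rightarrow> nat \<Rightarrow> real \<Rightarrow> real" where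
  "saw_sum t b x = (\<Sum>i\<in>UNIV. t i * (\<Sum>l=1..b. frac (real (A i) * x / real q ^ l) - 1/2))"

text \<open>The factor 16 collects a 2 and a 4 that bound geometric series, and the 2 of
  \<open>frac_shift_square_avg_le\<close>. What matters is that the number of scales
  \<open>b\<close> does not enter.\<close>

definition shift_const :: "('d \<Rightarrow> real) \<Rightarrow> real" where
  "shift_const t = 16 * real CARD('d) * (\<Sum>i\<in>UNIV. (t i * real (A i))\<^sup>2)"

text \<open>At scale \<open>l\<close> the perturbation has mean square of order
  \<open>q ^ (- l)\<close>. A weighted Cauchy-Schwarz inequality turns this decay into a bound for
  the sum over all scales, uniformly in \<open>b\<close>.\<close>

lemma saw_sum_shift_square_avg_le:
  assumes u: "0 \<le> u" "u < 1"
  shows "avg (q ^ b) (\<lambda>n. (saw_sum t b (real n + u) - saw_sum t b (real n))\<^sup>2) \<le> shift_const t"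
proof -
  define e where "e i l n = frac (real (A i) * (real n + u) / real q ^ l)
    - frac (real (A i) * real n / real q ^ l)"
    for i l n
  define I where "I = (UNIV :: 'd set) \<times> {1..b}"
  have e_avg: "avg (q ^ b) (\<lambda>n. (e i l n)\<^sup>2) \<le> 2 * (real (A i))\<^sup>2 / 2 ^ l" if "l \<le> b" for i l
  proof -
    \<comment> \<open>Replacing \<open>n\<close> by its residue modulo \<open>q ^ l\<close> changes
      both arguments of \<open>frac\<close> by the same integer.\<close>
    have per: "e i l n = e i l (n mod q ^ l)" for n
    proof -
      define k where "k = n div q ^ l"
      have n: "real n = real (n mod q ^ l) + real q ^ l * real k"
        by (metis k_def mod_mult_div_eq of_nat_add of_nat_mult of_nat_power)
      have *: "real (A i) * (real n + v) / real q ^ l =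
          real (A i) * (real (n mod q ^ l) + v) / real q ^ l + of_int (int (A i * k))" for v
        using q_ge_2 by (subst n) (simp add: field_simps)
      show ?thesis unfolding e_def using *[of u] *[of 0]
        by (simp only: frac_add_of_int_right add_0_right)
    qed
    have "avg (q ^ b) (\<lambda>n. (e i l n)\<^sup>2) = avg (q ^ b) (\<lambda>n. (e i l (n mod q ^ l))\<^sup>2)"
      by (subst per) (rule refl)
    also have "\<dots> = avg (q ^ l) (\<lambda>n. (e i l n)\<^sup>2)"
      using q_ge_2 that by (intro avg_mod) (auto simp: le_imp_power_dvd)
    also have "\<dots> \<le> 2 * (real (A i))\<^sup>2 / real (q ^ l)"
      using frac_shift_square_avg_le[OF A_pos _ u, of "q ^ l" i] q_ge_2 by (simp add: e_def)
    also have "\<dots> \<le> 2 * (real (A i))\<^sup>2 / 2 ^ l"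
      using q_ge_2 by (intro divide_left_mono) (auto intro!: power_mono)
    finally show ?thesis .
  qed
  have "(saw_sum t b (real n + u) - saw_sum t b (real n))\<^sup>2
    \<le> (2 * real CARD('d)) * (\<Sum>(i, l)\<in>I. (t i)\<^sup>2 * (25/16) ^ l * (e i l n)\<^sup>2)" for n
  proof -
    have "saw_sum t b (real n + u) - saw_sum t b (real n) = (\<Sum>i\<in>UNIV. \<Sum>l=1..b. t i * e i l n)"
      unfolding saw_sum_def e_def sum_distrib_left
      by (simp add: sum_subtractf[symmetric] right_diff_distrib[symmetric])
    also have "\<dots> = (\<Sum>(i, l)\<in>I. t i * e i l n)"
      by (simp add: I_def sum.cartesian_product)
    \<comment> \<open>The weights \<open>(4/5) ^ l\<close> have summable squares, while the
      compensating factors \<open>(25/16) ^ l\<close> against mean squares of order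
      \<open>1 / 2 ^ l\<close> leave the summable \<open>(25/32) ^ l\<close>.\<close>
    also have "\<dots> = (\<Sum>x\<in>I. (4/5) ^ snd x * (t (fst x) * (5/4) ^ snd x * e (fst x) (snd x) n))"
      by (intro sum.cong) (auto simp: power_divide)
    finally have eq: "saw_sum t b (real n + u) - saw_sum t b (real n) = \<dots>" .
    have "(saw_sum t b (real n + u) - saw_sum t b (real n))\<^sup>2
      \<le> (\<Sum>x\<in>I. ((4/5) ^ snd x)\<^sup>2) * (\<Sum>x\<in>I. (t (fst x) * (5/4) ^ snd x * e (fst x) (snd x) n)\<^sup>2)"
      unfolding eq by (rule Cauchy_Schwarz_ineq_sum)
    also have "(\<Sum>x\<in>I. ((4/5::real) ^ snd x)\<^sup>2) = (\<Sum>i\<in>(UNIV::'d set). \<Sum>l=1..b. (16/25) ^ l)"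
    proof -
      have "((4/5::real) ^ l)\<^sup>2 = (16/25) ^ l" for l
        by (simp add: power_mult[symmetric] mult.commute[of _ 2]) (simp add: power_mult
          power_divide)
      then show ?thesis unfolding I_def by (simp add: sum.cartesian_product')
    qed
    also have "\<dots> \<le> 2 * real CARD('d)"
      using mult_left_mono[OF sum_power_le[of "16/25" b], of "real CARD('d)"] by simp
    also have "(\<Sum>x\<in>I. (t (fst x) * (5/4) ^ snd x * e (fst x) (snd x) n)\<^sup>2)
      = (\<Sum>(i, l)\<in>I. (t i)\<^sup>2 * (25/16) ^ l * (e i l n)\<^sup>2)"
      by (intro sum.cong refl) (simp add: power_mult_distrib power_divide case_prod_beta
        power_mult[symmetric] mult.commute[of _ 2] power_mult)
    finally show ?thesis
      by (simp add: mult_right_mono sum_nonneg case_prod_beta)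
  qed
  then have "avg (q ^ b) (\<lambda>n. (saw_sum t b (real n + u) - saw_sum t b (real n))\<^sup>2)
    \<le> avg (q ^ b) (\<lambda>n. (2 * real CARD('d)) * (\<Sum>(i, l)\<in>I. (t i)\<^sup>2 * (25/16) ^ l * (e i l n)\<^sup>2))"
    by (intro avg_mono)
  also have "\<dots> = (2 * real CARD('d)) * (\<Sum>(i, l)\<in>I. (t i)\<^sup>2 * (25/16) ^ l * avg (q ^ b) (\<lambda>n. (e i l
    n)\<^sup>2))"
    by (simp add: avg_mult_left avg_sum case_prod_beta)
  also have "\<dots> \<le> (2 * real CARD('d)) * (\<Sum>(i, l)\<in>I. (t i)\<^sup>2 * (25/16) ^ l * (2 * (real (A i))\<^sup>2 / 2 ^
    l))"
    unfolding case_prod_beta by (intro mult_left_mono sum_mono e_avg) (auto simp: I_def)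
  also have "(\<Sum>(i, l)\<in>I. (t i)\<^sup>2 * (25/16) ^ l * (2 * (real (A i))\<^sup>2 / 2 ^ l)) =
      (\<Sum>i\<in>UNIV. 2 * (t i * real (A i))\<^sup>2 * (\<Sum>l=1..b. (25/32) ^ l))"
  proof -
    have "(t i)\<^sup>2 * (25/16) ^ l * (2 * (real (A i))\<^sup>2 / 2 ^ l)
      = 2 * (t i * real (A i))\<^sup>2 * (25/32) ^ l" for i l
    proof -
      have "(25/32::real) ^ l = (25/16) ^ l / 2 ^ l" by (simp add: power_divide[symmetric])
      then show ?thesis by (simp add: power_mult_distrib)
    qed
    then show ?thesis unfolding I_def by (simp add: sum.cartesian_product' sum_distrib_left)
  qed
  also have "\<dots> \<le> (\<Sum>i\<in>UNIV. 2 * (t i * real (A i))\<^sup>2 * 4)"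
    using sum_power_le[of "25/32" b] by (intro sum_mono mult_left_mono) auto
  also have "2 * real CARD('d) * \<dots> = shift_const t"
    by (simp add: shift_const_def sum_distrib_left mult.assoc)
  finally show ?thesis by simp
qed

text \<open>At a scale up to \<open>a\<close> the part \<open>real q ^ a * real y\<close>
  contributes an integer and drops out. At a scale \<open>l + a\<close> the argument is that of
  scale \<open>l\<close> at \<open>y\<close>, perturbed by the rescaled low part
  \<open>x / q ^ a\<close>. This is how shifts of the argument arise.\<close>

lemma saw_sum_split:
  "saw_sum t (a + b) (x + real q ^ a * real y) = saw_sum t a x + saw_sum t b (real y
    + x / real q ^ a)"
proof -
  define s where "s i l = frac (real (A i) * (x + real q ^ a * real y) / real q ^ l) - 1/2" for i l
  have "(\<Sum>l=1..a+b. s i l) = (\<Sum>l=1..a. frac (real (A i) * x / real q ^ l) - 1/2) +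
       (\<Sum>l=1..b. frac (real (A i) * (real y + x / real q ^ a) / real q ^ l) - 1/2)" for i
  proof -
    have "(\<Sum>l=1..a+b. s i l) = (\<Sum>l=1..a. s i l) + (\<Sum>l=a+1..a+b. s i l)"
      by (rule sum.ub_add_nat) simp
    also have "(\<Sum>l=a+1..a+b. s i l) = (\<Sum>l=1..b. s i (l + a))"
      using sum.shift_bounds_cl_nat_ivl[of "s i" 1 a b] by (simp add: add.commute)
    also have "\<dots> = (\<Sum>l=1..b. frac (real (A i) * (real y + x / real q ^ a) / real q ^ l) - 1/2)"
    proof (rule sum.cong[OF refl])
      fix l
      have "real (A i) * (x + real q ^ a * real y) / real q ^ (l + a) =
          real (A i) * (real y + x / real q ^ a) / real q ^ l"
        using q_ge_2 by (simp add: power_add field_simps)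
      then show "s i (l + a) = frac (real (A i) * (real y + x / real q ^ a) / real q ^ l) - 1/2"
        by (simp add: s_def)
    qed
    also have "(\<Sum>l=1..a. s i l) = (\<Sum>l=1..a. frac (real (A i) * x / real q ^ l) - 1/2)"
    proof (rule sum.cong[OF refl])
      fix l assume "l \<in> {1..a}"
      then have "real q ^ a = real q ^ l * real q ^ (a - l)" by (simp flip: power_add)
      then have "real (A i) * (x + real q ^ a * real y) / real q ^ l =
        real (A i) * x / real q ^ l + of_int (int (A i * q ^ (a - l) * y))"
        using q_ge_2 by (simp add: field_simps)
      then show "s i l = frac (real (A i) * x / real q ^ l) - 1/2"
        unfolding s_def by (simp only: frac_add_of_int_right)
    qed
    finally show ?thesis .
  qed
  then show ?thesis
    by (simp add: saw_sum_def s_def sum.distrib[symmetric] distrib_left[symmetric])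
qed

section \<open>Exact second moments after refinement\<close>

definition D :: nat where "D = (\<Prod>i\<in>UNIV. A i)"

text \<open>At a refined point \<open>n / D\<close> the multiplier disappears:
  \<open>A i * (n / D)\<close> is \<open>n / P i\<close>, so the sawtooth at scale \<open>l\<close>
  depends only on the residue of \<open>n\<close> modulo \<open>P i * q ^ l\<close>.\<close>

definition P :: "'d \<Rightarrow> nat" where "P i = D div A i"

lemma D_pos: "D > 0" using A_pos by (simp add: D_def)

lemma A_mult_P: "A i * P i = D"
  unfolding P_def by (rule dvd_mult_div_cancel) (auto simp: D_def)

lemma P_pos: "P i > 0" using A_mult_P[of i] D_pos by (metis gr0I mult_0_right)

lemma P_dvd_D: "P i dvd D" using A_mult_P[of i] by (metis dvd_triv_right)

lemma saw_sum_rescaled: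
  "saw_sum t b (real n / real D) =
    (\<Sum>i\<in>UNIV. \<Sum>l=1..b. t i * (real (n mod (P i * q ^ l)) / real (P i * q ^ l) - 1/2))"
proof -
  have "frac (real (A i) * (real n / real D) / real q ^ l)
    = real (n mod (P i * q ^ l)) / real (P i * q ^ l)" for i l
  proof -
    have "real (A i) * (real n / real D) / real q ^ l = real n / real (P i * q ^ l)"
      using A_pos[of i] by (simp flip: A_mult_P[of i])
    then show ?thesis
      using frac_of_nat_divide[of "P i * q ^ l" n] P_pos[of i] q_ge_2 by simp
  qed
  then show ?thesis by (simp add: saw_sum_def sum_distrib_left)
qed

lemma P_dvd: "l \<le> b \<Longrightarrow> P i * q ^ l dvd D * q ^ b"
  by (intro mult_dvd_mono P_dvd_D le_imp_power_dvd)

text \<open>By \<open>avg_saw_saw\<close> each summand is the average of a product of two sawtooth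
  functions. The total is the mixed second moment, not centred at the means, of the refined sawtooth
  sums belonging to \<open>i\<close> and \<open>j\<close>.\<close>

definition saw_moment :: "nat \<Rightarrow> 'd \<Rightarrow> 'd \<Rightarrow> real" where
  "saw_moment b i j = (\<Sum>l=1..b. \<Sum>m=1..b. ((real (gcd (P i * q ^ l) (P j * q ^ m)))\<^sup>2 + 2) /
     (12 * real (P i * q ^ l) * real (P j * q ^ m)))"

lemma avg_saw_sum_rescaled_square:
  "avg (D * q ^ b) (\<lambda>n. (saw_sum t b (real n / real D))\<^sup>2)
    = (\<Sum>i\<in>UNIV. \<Sum>j\<in>UNIV. t i * t j * saw_moment b i j)"
proof -
  define s where "s i l n = real (n mod (P i * q ^ l)) / real (P i * q ^ l) - 1/2" for i l n
  have "avg (D * q ^ b) (\<lambda>n. (saw_sum t b (real n / real D))\<^sup>2) =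
      avg (D * q ^ b) (\<lambda>n. \<Sum>i\<in>UNIV. \<Sum>j\<in>UNIV. \<Sum>l=1..b. \<Sum>m=1..b. t i * t j * (s i l n * s j m n))"
    unfolding saw_sum_rescaled power2_eq_square s_def[symmetric] sum_product
    by (intro avg_cong sum.cong refl) (simp add: sum_distrib_left sum_product ac_simps)
  also have "\<dots> = (\<Sum>i\<in>UNIV. \<Sum>j\<in>UNIV. \<Sum>l=1..b. \<Sum>m=1..b. t i * t j * avg (D * q ^ b) (\<lambda>n. s i l n * s j
    m n))"
    by (simp add: avg_sum avg_mult_left)
  also have "\<dots> = (\<Sum>i\<in>UNIV. \<Sum>j\<in>UNIV. t i * t j * saw_moment b i j)"
    unfolding saw_moment_def sum_distrib_left
  proof (intro sum.cong refl)
    fix i j l m assume "l \<in> {1..b}" "m \<in> {1..b}"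
    then show "t i * t j * avg (D * q ^ b) (\<lambda>n. s i l n * s j m n) = t i * t j *
      (((real (gcd (P i * q ^ l) (P j * q ^ m)))\<^sup>2
        + 2) / (12 * real (P i * q ^ l) * real (P j * q ^ m)))"
      unfolding s_def using P_pos D_pos q_ge_2 by (subst avg_saw_saw) (auto intro: P_dvd)
  qed
  finally show ?thesis .
qed

text \<open>For \<open>n = x + D * y\<close> with \<open>x < D\<close> the refined point is
  \<open>y + x / D\<close>, a shift of \<open>y = n div D\<close> by a number in
  \<open>[0, 1)\<close>.\<close>

lemma avg_saw_sum_rescaled_diff:
  "avg (D * q ^ b) (\<lambda>n. (saw_sum t b (real n / real D) - saw_sum t b (real (n div D)))\<^sup>2)
    \<le> shift_const t"
proof -
  have "avg (D * q ^ b) (\<lambda>n. (saw_sum t b (real n / real D) - saw_sum t b (real (n div D)))\<^sup>2) =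
    avg D (\<lambda>x. avg (q ^ b) (\<lambda>y. (saw_sum t b (real y + real x / real D) - saw_sum t b (real y))\<^sup>2))"
    unfolding avg_lessThan_mult using D_pos by (intro avg_cong) (simp add: add_divide_distrib
      add.commute)
  also have "\<dots> \<le> shift_const t"
    using D_pos by (intro avg_le_const saw_sum_shift_square_avg_le) auto
  finally show ?thesis .
qed

lemma avg_div_rescaled: "avg (D * q ^ b) (\<lambda>n. f (n div D)) = avg (q ^ b) f"
proof -
  have "avg (D * q ^ b) (\<lambda>n. f (n div D)) = avg D (\<lambda>x. avg (q ^ b) f)"
    unfolding avg_lessThan_mult using D_pos by (intro avg_cong) simp
  then show ?thesis using D_pos by (simp add: avg_const)
qed

text \<open>At refined points the means of the sawtooth functions form a geometric series over the
  scales, and returning to integer points costs at most the root of \<open>shift_const t\<close>.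
  The mean thus stays bounded in \<open>b\<close>.\<close>

lemma abs_avg_saw_sum_le: "\<bar>avg (q ^ b) (\<lambda>n. saw_sum t b (real n))\<bar> \<le> (\<Sum>i\<in>UNIV. \<bar>t i\<bar>)
  + sqrt (shift_const t)"
proof -
  let ?m = "D * q ^ b"
  have "avg (q ^ b) (\<lambda>n. saw_sum t b (real n)) = avg ?m (\<lambda>n. saw_sum t b (real n / real D)) -
      avg ?m (\<lambda>n. saw_sum t b (real n / real D) - saw_sum t b (real (n div D)))"
    by (simp add: avg_diff avg_div_rescaled[of b "\<lambda>n. saw_sum t b (real n)"])
  moreover have "\<bar>avg ?m (\<lambda>n. saw_sum t b (real n / real D))\<bar> \<le> (\<Sum>i\<in>UNIV. \<bar>t i\<bar>)"
  proof -
    have "avg ?m (\<lambda>n. saw_sum t b (real n / real D))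
      = (\<Sum>i\<in>UNIV. \<Sum>l=1..b. t i * (- 1 / (2 * real (P i * q ^ l))))"
      unfolding saw_sum_rescaled avg_sum avg_mult_left using P_pos D_pos q_ge_2
      by (intro sum.cong refl, subst avg_saw) (auto intro: P_dvd)
    also have "\<bar>\<dots>\<bar> \<le> (\<Sum>i\<in>UNIV. \<Sum>l=1..b. \<bar>t i\<bar> * (1/2) ^ l)"
    proof (rule order_trans[OF sum_abs sum_mono[OF order_trans[OF sum_abs sum_mono]]])
      fix i l
      have "(1::real) * 2 ^ l \<le> (2 * real (P i)) * real q ^ l"
        using q_ge_2 P_pos[of i] by (intro mult_mono power_mono) auto
      then have "2 ^ l \<le> 2 * real (P i * q ^ l)" by simp
      then have "1 / (2 * real (P i * q ^ l)) \<le> 1 / 2 ^ l"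
        using P_pos[of i] q_ge_2 by (intro divide_left_mono) auto
      then have "\<bar>t i\<bar> * (1 / (2 * real (P i * q ^ l))) \<le> \<bar>t i\<bar> * (1 / 2 ^ l)"
        by (rule mult_left_mono) simp
      then show "\<bar>t i * (- 1 / (2 * real (P i * q ^ l)))\<bar> \<le> \<bar>t i\<bar> * (1/2) ^ l"
        by (simp add: abs_mult power_divide)
    qed
    also have "\<dots> = (\<Sum>i\<in>UNIV. \<bar>t i\<bar> * (\<Sum>l=1..b. (1/2) ^ l))" by (simp add: sum_distrib_left)
    also have "\<dots> \<le> (\<Sum>i\<in>UNIV. \<bar>t i\<bar> * 1)"
      using sum_power_le[of "1/2" b] by (intro sum_mono mult_left_mono) auto
    finally show ?thesis by simp
  qed
  moreover have "\<bar>avg ?m (\<lambda>n. saw_sum t b (real n / real D) - saw_sum t b (real (n div D)))\<bar>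
    \<le> sqrt (shift_const t)"
    using norm_avg_le[of ?m "\<lambda>n. saw_sum t b (real n / real D) - saw_sum t b (real (n div D))"]
      avg_abs_le[of ?m "\<lambda>n. saw_sum t b (real n / real D) - saw_sum t b (real (n div D))"]
      real_sqrt_le_mono[OF avg_saw_sum_rescaled_diff[where t=t and b=b]]
    unfolding real_norm_def by linarith
  ultimately show ?thesis by linarith
qed

text \<open>With \<open>?g\<close> the refined and \<open>?f\<close> the original functional,
  \<open>?f\<close> squared is expanded around \<open>?g\<close>, and Cauchy-Schwarz controls the
  cross term. Since \<open>H t b\<close> grows at most linearly in \<open>b\<close>, the error is of
  order \<open>sqrt b\<close>.\<close>

lemma abs_avg_saw_sum_square_diff_le:
  defines "H \<equiv> \<lambda>t b. \<Sum>i\<in>UNIV. \<Sum>j\<in>UNIV. t i * t j * saw_moment b i j"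
  shows "\<bar>avg (q ^ b) (\<lambda>n. (saw_sum t b (real n))\<^sup>2) - H t b\<bar> \<le> 2 * sqrt (shift_const t * H t b)
    + shift_const t"
proof -
  let ?m = "D * q ^ b"
  let ?g = "\<lambda>n. saw_sum t b (real n / real D)" and ?f = "\<lambda>n. saw_sum t b (real (n div D))"
  have "avg (q ^ b) (\<lambda>n. (saw_sum t b (real n))\<^sup>2) = avg ?m (\<lambda>n. (?f n)\<^sup>2)"
    by (rule avg_div_rescaled[symmetric])
  also have "\<dots> = avg ?m (\<lambda>n. (?g n)\<^sup>2 - 2 * ((?g n - ?f n) * ?g n) + (?g n - ?f n)\<^sup>2)"
    by (intro avg_cong) (simp add: power2_eq_square algebra_simps)
  also have "\<dots> = H t b - 2 * avg ?m (\<lambda>n. (?g n - ?f n) * ?g n) + avg ?m (\<lambda>n. (?g n - ?f n)\<^sup>2)"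
    unfolding H_def avg_saw_sum_rescaled_square[symmetric]
    by (simp only: avg_add avg_diff avg_mult_left)
  finally have "avg (q ^ b) (\<lambda>n. (saw_sum t b (real n))\<^sup>2) - H t b =
     - 2 * avg ?m (\<lambda>n. (?g n - ?f n) * ?g n) + avg ?m (\<lambda>n. (?g n - ?f n)\<^sup>2)" by simp
  moreover have "\<bar>avg ?m (\<lambda>n. (?g n - ?f n) * ?g n)\<bar> \<le> sqrt (shift_const t * H t b)"
    by (rule abs_avg_mult_le) (simp_all only: avg_saw_sum_rescaled_diff avg_saw_sum_rescaled_square
      H_def order_refl)
  moreover have "0 \<le> avg ?m (\<lambda>n. (?g n - ?f n)\<^sup>2)" by (rule avg_nonneg) simp
  ultimately show ?thesis using avg_saw_sum_rescaled_diff[of b t] by linarith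
qed


section \<open>The limiting covariances\<close>

text \<open>The sawtooth correlation of \<open>avg_saw_saw\<close> at lag \<open>d\<close>, for the
  moduli \<open>P i\<close> and \<open>P j * q ^ d\<close>, without its correction
  \<open>+ 2\<close>. This main part is invariant under multiplying both moduli by a power of
  \<open>q\<close>.\<close>

definition \<kappa> :: "'d \<Rightarrow> 'd \<Rightarrow> nat \<Rightarrow> real" where
  "\<kappa> i j d = (real (gcd (P i) (P j * q ^ d)))\<^sup>2 / (12 * real (P i) * real (P j) * real q ^ d)"

text \<open>The smaller power of \<open>q\<close> can be pulled out of the gcd and cancels, so only
  the lag between the scales remains; for \<open>l > m\<close> the roles of \<open>i\<close> and
  \<open>j\<close> are exchanged.\<close>

lemma gcd_P_mult_power:
  "(real (gcd (P i * q ^ l) (P j * q ^ m)))\<^sup>2 / (12 * real (P i * q ^ l) * real (P j * q ^ m)) =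
    (if l \<le> m then \<kappa> i j (m - l) else \<kappa> j i (l - m))"
proof -
  have *: "(real (gcd (P i * q ^ l) (P j * q ^ m)))\<^sup>2 / (12 * real (P i * q ^ l) * real (P j * q ^
    m)) =
    \<kappa> i j (m - l)" if "l \<le> m" for i j l m
  proof -
    have m: "q ^ m = q ^ l * q ^ (m - l)" using that by (simp flip: power_add)
    have "gcd (P i * q ^ l) (P j * q ^ m) = q ^ l * gcd (P i) (P j * q ^ (m - l))"
      unfolding m by (metis gcd_mult_distrib_nat mult.commute mult.left_commute)
    then show ?thesis
      using q_ge_2 unfolding \<kappa>_def m by (simp add: power2_eq_square)
  qed
  show ?thesis
    using *[of l m i j] *[of m l j i] by (auto simp: gcd.commute mult.commute mult.left_commute)
qed

lemma summable_\<kappa>: "summable (\<kappa> i j)"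
proof (rule summable_comparison_test')
  show "summable (\<lambda>d. (real (P i))\<^sup>2 / (12 * real (P i) * real (P j)) * (1 / real q) ^ d)"
    using q_ge_2 by (intro summable_mult summable_geometric) auto
  fix d :: nat
  have "gcd (P i) (P j * q ^ d) \<le> P i" using P_pos by (simp add: gcd_le1_nat)
  then have "(real (gcd (P i) (P j * q ^ d)))\<^sup>2 \<le> (real (P i))\<^sup>2"
    by (intro power_mono) auto
  then have "(real (gcd (P i) (P j * q ^ d)))\<^sup>2 / (12 * real (P i) * real (P j) * real q ^ d) \<le>
    (real (P i))\<^sup>2 / (12 * real (P i) * real (P j) * real q ^ d)"
    by (intro divide_right_mono) auto
  then show "norm (\<kappa> i j d) \<le> (real (P i))\<^sup>2 / (12 * real (P i) * real (P j)) * (1 / real q) ^ d"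
    by (simp add: \<kappa>_def power_divide)
qed

text \<open>The main part \<open>X\<close> depends only on the lags, so the Cesaro lemma for double
  sums applies. The corrections \<open>+ 2\<close> factor into a product of two geometric sums; this
  part \<open>y\<close> is bounded and vanishes after division by \<open>b\<close>.\<close>

lemma saw_moment_limit: "(\<lambda>b. saw_moment b i j / real b) \<longlonglongrightarrow> (\<Sum>d. \<kappa> i j d) + (\<Sum>d. \<kappa> j i (Suc d))"
proof -
  define X where "X b = (\<Sum>l<b. \<Sum>m<b. if l \<le> m then \<kappa> i j (m - l) else \<kappa> j i (l - m))" for b
  define c where "c = 2 / (12 * real (P i) * real (P j))"
  define y where "y b = c * (\<Sum>l=1..b. (1 / real q) ^ l)\<^sup>2" for b
  have saw_moment: "saw_moment b i j = X b + y b" for b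
  proof -
    have "saw_moment b i j = (\<Sum>l=1..b. \<Sum>m=1..b. (if l \<le> m then \<kappa> i j (m - l) else \<kappa> j i (l - m)))
       + (\<Sum>l=1..b. \<Sum>m=1..b. c * ((1 / real q) ^ l * (1 / real q) ^ m))"
      unfolding saw_moment_def add_divide_distrib gcd_P_mult_power sum.distrib
      by (simp add: c_def power_divide ac_simps)
    also have "(\<Sum>l=1..b. \<Sum>m=1..b. c * ((1 / real q) ^ l * (1 / real q) ^ m)) = y b"
      unfolding y_def power2_eq_square sum_product by (simp only: sum_distrib_left)
    also have "(\<Sum>l=1..b. \<Sum>m=1..b. (if l \<le> m then \<kappa> i j (m - l) else \<kappa> j i (l - m))) = X b"
      unfolding X_def One_nat_def sum.atLeast1_atMost_eq
      by (simp only: diff_Suc_Suc Suc_le_mono)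
    finally show ?thesis .
  qed
  have "(\<lambda>b. y b / real b) \<longlonglongrightarrow> 0"
  proof (rule Lim_null_comparison)
    have "norm (y b) \<le> c" for b
    proof -
      have "(\<Sum>l=1..b. (1 / real q) ^ l) \<le> (1 / real q) / (1 - 1 / real q)"
        using q_ge_2 by (intro sum_power_le) auto
      also have "\<dots> \<le> 1" using q_ge_2 by (simp add: field_simps)
      finally have "(\<Sum>l=1..b. (1 / real q) ^ l)\<^sup>2 \<le> 1" by (simp add: abs_square_le_1 sum_nonneg)
      then show ?thesis by (simp add: y_def c_def divide_right_mono)
    qed
    then show "\<forall>\<^sub>F b in sequentially. norm (y b / real b) \<le> c / real b"
      by (simp add: divide_right_mono)
    show "(\<lambda>b. c / real b) \<longlonglongrightarrow> 0" by (rule lim_const_over_n)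
  qed
  moreover have "(\<lambda>b. X b / real b) \<longlonglongrightarrow> (\<Sum>d. \<kappa> i j d) + (\<Sum>d. \<kappa> j i (Suc d))"
    unfolding X_def using summable_\<kappa>
    by (intro double_sum_Cesaro_limit summable_sums) (auto simp: summable_Suc_iff)
  ultimately have "(\<lambda>b. X b / real b + y b / real b) \<longlonglongrightarrow> (\<Sum>d. \<kappa> i j d) + (\<Sum>d. \<kappa> j i (Suc d)) + 0"
    by (intro tendsto_add)
  then show ?thesis by (simp add: saw_moment add_divide_distrib)
qed

text \<open>The factor \<open>(real q - 1)\<^sup>2\<close> comes from Legendre's formula. Lag 0 is
  counted only in the first series.\<close>

definition \<Sigma> :: "'d \<Rightarrow> 'd \<Rightarrow> real" where
  "\<Sigma> i j = (real q - 1)\<^sup>2 * ((\<Sum>d. \<kappa> i j d) + (\<Sum>d. \<kappa> j i (Suc d)))"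

text \<open>Multiplying the gcd of the cofactors by \<open>A i * A j\<close> gives
  \<open>D * gcd (A i) (A j)\<close>, so the normalised gcd is the same for the cofactors
  \<open>P\<close> as for the multipliers \<open>A\<close>.\<close>

lemma \<kappa>_0: "\<kappa> i j 0 = (real (gcd (A i) (A j)))\<^sup>2 / (12 * real (A i) * real (A j))"
proof -
  have "A i * A j * gcd (P i) (P j) = gcd (D * A j) (D * A i)"
  proof -
    have "A i * A j * P i = D * A j" "A i * A j * P j = D * A i"
      by (simp flip: A_mult_P[of i], simp flip: A_mult_P[of j])
    then show ?thesis by (simp only: gcd_mult_distrib_nat)
  qed
  also have "\<dots> = D * gcd (A i) (A j)" by (metis gcd.commute gcd_mult_distrib_nat)
  finally have "real (A i) * real (A j) * real (gcd (P i) (P j)) = real D * real (gcd (A i) (A j))"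
    by (metis of_nat_mult)
  then have "(real (A i) * real (A j) * real (gcd (P i) (P j)))\<^sup>2
    = (real D * real (gcd (A i) (A j)))\<^sup>2"
    by simp
  also have "\<dots> = (real (A i) * real (P i)) * (real (A j) * real (P j)) * (real (gcd (A i) (A j)))\<^sup>2"
    by (simp add: power_mult_distrib power2_eq_square flip: of_nat_mult) (simp add: A_mult_P)
  finally show ?thesis
    using A_pos[of i] A_pos[of j] P_pos[of i] P_pos[of j]
    by (simp add: \<kappa>_def power_mult_distrib) (simp add: field_simps power2_eq_square)
qed

text \<open>Once lag 0 is split off, the two remaining series are exchanged by swapping the indices,
  and \<open>\<kappa>_0\<close> shows that the split term is symmetric.\<close>

lemma \<Sigma>_sym: "\<Sigma> i j = \<Sigma> j i"
  unfolding \<Sigma>_def suminf_split_head[OF summable_\<kappa>] \<kappa>_0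
  by (simp add: gcd.commute mult.commute mult.left_commute)

text \<open>Here \<open>q\<close> is coprime to every \<open>P i\<close>, so powers of
  \<open>q\<close> do not affect the gcd and \<kappa> is a geometric sequence with ratio
  \<open>1 / q\<close>; both series then have closed forms.\<close>

lemma \<Sigma>_prime:
  assumes "prime q" "\<And>i. \<not> q dvd A i"
  shows "\<Sigma> i j = ((real q)\<^sup>2 - 1) / 12 * ((real (gcd (A i) (A j)))\<^sup>2 / (real (A i) * real (A j)))"
proof -
  \<comment> \<open>Primality enters here: \<open>q\<close> divides no factor of the product, hence
    not the product.\<close>
  have "\<not> q dvd D" using assms by (simp add: D_def prime_dvd_prod_iff)
  then have "\<not> q dvd P i" for i using P_dvd_D dvd_trans by blast
  then have cop: "coprime (P i) (q ^ d)" for i d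
    using prime_imp_coprime[OF assms(1), of "P i"] by (simp add: coprime_commute)
  have \<kappa>: "\<kappa> i j d = \<kappa> i j 0 * (1 / real q) ^ d" for i j d
    using cop[of i d] by (simp add: \<kappa>_def gcd_mult_right_right_cancel power_divide)
  have s: "\<kappa> i j sums (\<kappa> i j 0 * (1 / (1 - 1 / real q)))" for i j
    using q_ge_2 by (subst \<kappa>[abs_def]) (intro sums_mult geometric_sums, auto)
  have "(\<lambda>d. \<kappa> i j (Suc d)) sums (\<kappa> i j 0 * (1 / (1 - 1 / real q)) - \<kappa> i j 0)" for i j
    using s by (subst sums_Suc_iff) simp
  then have "\<Sigma> i j = (real q - 1)\<^sup>2 * (\<kappa> i j 0 * (1 / (1 - 1 / real q)) + (\<kappa> j i 0 * (1 / (1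
    - 1 / real q)) - \<kappa> j i 0))"
    unfolding \<Sigma>_def using s by (simp add: sums_iff)
  also have "\<kappa> j i 0 = \<kappa> i j 0" by (simp add: \<kappa>_0 gcd.commute)
  also have "(real q - 1)\<^sup>2 * (\<kappa> i j 0 * (1 / (1 - 1 / real q)) + (\<kappa> i j 0 * (1 / (1 - 1 / real q))
    - \<kappa> i j 0))
    = ((real q)\<^sup>2 - 1) * \<kappa> i j 0"
  proof -
    define z where "z = real q - 1"
    have z: "z > 0" "real q = z + 1" using q_ge_2 by (auto simp: z_def)
    show ?thesis unfolding z(2) using z(1) by (simp add: field_simps power2_eq_square)
  qed
  finally show ?thesis by (simp add: \<kappa>_0)
qed

text \<open>The asymptotic variance per scale of the sawtooth sum. At the weights
  \<open>(real q - 1) * t i\<close> it becomes the quadratic form of \<Sigma> at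
  \<open>t\<close>.\<close>

definition saw_var :: "('d \<Rightarrow> real) \<Rightarrow> real" where
  "saw_var t = (\<Sum>i\<in>UNIV. \<Sum>j\<in>UNIV. t i * t j * ((\<Sum>d. \<kappa> i j d) + (\<Sum>d. \<kappa> j i (Suc d))))"

text \<open>The refined second moment \<open>H b\<close> has this limit after division by
  \<open>b\<close>, and the cost of passing back to integer points is of lower order.\<close>

lemma saw_sum_square_limit: "(\<lambda>b. avg (q ^ b) (\<lambda>n. (saw_sum t b (real n))\<^sup>2) / real b) \<longlonglongrightarrow> saw_var t"
proof -
  define H where "H b = (\<Sum>i\<in>UNIV. \<Sum>j\<in>UNIV. t i * t j * saw_moment b i j)" for b
  have H: "(\<lambda>b. H b / real b) \<longlonglongrightarrow> saw_var t"
  proof -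
    have "(\<lambda>b. \<Sum>i\<in>UNIV. \<Sum>j\<in>UNIV. t i * t j * (saw_moment b i j / real b)) \<longlonglongrightarrow> saw_var t"
      unfolding saw_var_def by (intro tendsto_sum tendsto_mult tendsto_const saw_moment_limit)
    then show ?thesis by (simp add: H_def sum_divide_distrib)
  qed
  have "(\<lambda>b. avg (q ^ b) (\<lambda>n. (saw_sum t b (real n))\<^sup>2) / real b - H b / real b) \<longlonglongrightarrow> 0"
  proof (rule Lim_null_comparison)
    show "\<forall>\<^sub>F b in sequentially. norm (avg (q ^ b) (\<lambda>n. (saw_sum t b (real n))\<^sup>2) / real b
      - H b / real b) \<le>
      2 * sqrt (shift_const t * (H b / real b) * (1 / real b)) + shift_const t / real b"
    proof (rule eventually_sequentiallyI[of 1])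
      fix b :: nat assume b: "1 \<le> b"
      have "norm (avg (q ^ b) (\<lambda>n. (saw_sum t b (real n))\<^sup>2) / real b - H b / real b) =
          \<bar>avg (q ^ b) (\<lambda>n. (saw_sum t b (real n))\<^sup>2) - H b\<bar> / real b"
        by (simp flip: diff_divide_distrib)
      also have "\<dots> \<le> (2 * sqrt (shift_const t * H b) + shift_const t) / real b"
        using abs_avg_saw_sum_square_diff_le[of b t] by (intro divide_right_mono) (auto simp: H_def)
      also have "\<dots> = 2 * sqrt (shift_const t * (H b / real b) * (1 / real b))
        + shift_const t / real b"
        using b by (simp add: add_divide_distrib real_sqrt_divide)
      finally show "norm (avg (q ^ b) (\<lambda>n. (saw_sum t b (real n))\<^sup>2) / real b - H b / real b) \<le>
         2 * sqrt (shift_const t * (H b / real b) * (1 / real b)) + shift_const t / real b" .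
    qed
    have "(\<lambda>b. 2 * sqrt (shift_const t * (H b / real b) * (1 / real b)) + shift_const t / real b)
      \<longlonglongrightarrow> 2 * sqrt (shift_const t * saw_var t * 0) + 0"
      by (intro tendsto_intros H lim_const_over_n)
    then show "(\<lambda>b. 2 * sqrt (shift_const t * (H b / real b) * (1 / real b))
      + shift_const t / real b) \<longlonglongrightarrow> 0" by simp
  qed
  from tendsto_add[OF this H] show ?thesis by simp
qed

text \<open>A limit of averages of squares. This is the source of the positive semi-definiteness of
  the covariance matrix.\<close>

lemma saw_var_nonneg: "0 \<le> saw_var t"
  by (rule tendsto_lowerbound[OF saw_sum_square_limit]) (auto intro!: always_eventually avg_nonneg
    divide_nonneg_nonneg)


section \<open>Comparison with independent blocks\<close>

definition block_mean :: "('d \<Rightarrow> real) \<Rightarrow> nat \<Rightarrow> real" where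
  "block_mean t p = avg (q ^ p) (\<lambda>n. saw_sum t p (real n))"

definition block_dev :: "('d \<Rightarrow> real) \<Rightarrow> nat \<Rightarrow> nat \<Rightarrow> real" where
  "block_dev t p n = saw_sum t p (real n) - block_mean t p"

definition block_var :: "('d \<Rightarrow> real) \<Rightarrow> nat \<Rightarrow> real" where
  "block_var t p = avg (q ^ p) (\<lambda>n. (block_dev t p n)\<^sup>2)"

lemma q_power_pos: "q ^ p > 0" using q_ge_2 by simp

lemma avg_block_dev: "avg (q ^ p) (block_dev t p) = 0"
  unfolding block_dev_def[abs_def] avg_diff using q_power_pos
  by (simp add: avg_const block_mean_def)

lemma block_var_eq: "block_var t p = avg (q ^ p) (\<lambda>n. (saw_sum t p (real n))\<^sup>2)
  - (block_mean t p)\<^sup>2"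
proof -
  have "block_var t p = avg (q ^ p) (\<lambda>n. (saw_sum t p (real n))\<^sup>2
    - 2 * block_mean t p * saw_sum t p (real n) + (block_mean t p)\<^sup>2)"
    unfolding block_var_def block_dev_def by (intro avg_cong) (simp add: power2_eq_square
      algebra_simps)
  also have "\<dots> = avg (q ^ p) (\<lambda>n. (saw_sum t p (real n))\<^sup>2) - 2 * block_mean t p * block_mean t p
    + (block_mean t p)\<^sup>2"
    unfolding avg_add avg_diff avg_mult_left block_mean_def[symmetric] using q_power_pos
    by (simp add: avg_const)
  finally show ?thesis by (simp add: power2_eq_square)
qed

text \<open>The block means are bounded in \<open>p\<close>, so centring does not change the
  variance per digit in the limit.\<close>

lemma block_var_limit: "(\<lambda>p. block_var t p / real p) \<longlonglongrightarrow> saw_var t"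
proof -
  define c where "c = (\<Sum>i\<in>UNIV. \<bar>t i\<bar>) + sqrt (shift_const t)"
  have "(\<lambda>p. (block_mean t p)\<^sup>2 / real p) \<longlonglongrightarrow> 0"
  proof (rule Lim_null_comparison)
    have "(block_mean t p)\<^sup>2 \<le> c\<^sup>2" for p
      using abs_avg_saw_sum_le[of p t] unfolding block_mean_def c_def
      by (metis abs_ge_zero power2_abs power_mono)
    then show "\<forall>\<^sub>F p in sequentially. norm ((block_mean t p)\<^sup>2 / real p) \<le> c\<^sup>2 / real p"
      by (simp add: divide_right_mono)
    show "(\<lambda>p. c\<^sup>2 / real p) \<longlonglongrightarrow> 0" by (rule lim_const_over_n)
  qed
  from tendsto_diff[OF saw_sum_square_limit[of t] this] show ?thesis
    by (simp add: block_var_eq diff_divide_distrib)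
qed

text \<open>Shifting the argument by \<open>u\<close> is what makes the induction work: cutting off the lowest
  block turns the shift \<open>u\<close> into the shift \<open>(x + u) / q ^ p\<close>, which is again in \<open>[0,1)\<close>.\<close>

lemma avg_saw_sum_block_sum_ge:
  assumes "0 \<le> u" "u < 1"
  shows "real k * (block_var t p - 2 * sqrt (shift_const t * block_var t p)) \<le>
    avg ((q ^ p) ^ k) (\<lambda>n. saw_sum t (k * p) (real n + u) * block_sum (block_dev t p) (q ^ p) k n)"
  using assms
proof (induction k arbitrary: u)
  case (Suc k)
  define Q where "Q = q ^ p"
  have Q: "Q > 0" using q_power_pos by (simp add: Q_def)
  let ?T = "block_sum (block_dev t p) Q k"
  define w where "w x = (real x + u) / real Q" for x
  have w: "0 \<le> w x" "w x < 1" if "x < Q" for x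
  proof -
    have "real x + 1 \<le> real Q" using that by linarith
    then show "0 \<le> w x" "w x < 1" using Suc.prems Q by (auto simp: w_def field_simps)
  qed
  \<comment> \<open>\<open>g x\<close> is the mean of the higher part, which depends on the lowest
    block only through the shift \<open>w x\<close>; \<open>m0\<close> is its value at shift
    0.\<close>
  define g where "g x = avg (Q ^ k) (\<lambda>y. saw_sum t (k * p) (real y + w x))" for x
  define m0 where "m0 = avg (Q ^ k) (\<lambda>y. saw_sum t (k * p) (real y))"
  have Qk: "Q ^ k = q ^ (k * p)" by (simp add: Q_def power_mult[symmetric] mult.commute)
  have "avg (Q ^ Suc k) (\<lambda>n. saw_sum t (Suc k * p) (real n
    + u) * block_sum (block_dev t p) Q (Suc k) n) =
    avg Q (\<lambda>x. avg (Q ^ k) (\<lambda>y. (saw_sum t p (real x + u) + saw_sum t (k * p) (real y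
      + w x)) * (block_dev t p x + ?T y)))"
    unfolding avg_power_Suc
  proof (intro avg_cong)
    fix x y assume x: "x < Q"
    have "saw_sum t (Suc k * p) (real (x + Q * y) + u) = saw_sum t p (real x + u)
      + saw_sum t (k * p) (real y + w x)"
      using saw_sum_split[of t p "k * p" "real x + u" y]
      by (simp add: Q_def w_def add.assoc add.commute add.left_commute)
    then show "saw_sum t (Suc k * p) (real (x + Q * y) + u) * block_sum (block_dev t p) Q (Suc k) (x
      + Q * y) =
      (saw_sum t p (real x + u) + saw_sum t (k * p) (real y + w x)) * (block_dev t p x + ?T y)"
      by (simp only: block_sum_Suc[OF x])
  qed
  \<comment> \<open>Four contributions: the shift inside the lowest block, the block variance, the
    dependence of the mean of the higher part on \<open>x\<close>, and the same expression for
    \<open>k\<close> blocks. The constants \<open>block_mean t p\<close> and \<open>m0\<close>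
    multiply a mean-zero quantity and vanish on averaging. The first and third cost one
    \<open>sqrt (shift_const t * block_var t p)\<close> each.\<close>
  also have "\<dots> = avg Q (\<lambda>x. (saw_sum t p (real x + u) - saw_sum t p (real x)) * block_dev t p x
    + (block_dev t p x * block_dev t p x + block_mean t p * block_dev t p x)
      + ((g x - m0) * block_dev t p x + m0 * block_dev t p x)
        + avg (Q ^ k) (\<lambda>y. saw_sum t (k * p) (real y + w x) * ?T y))"
  proof (intro avg_cong)
    fix x
    have "avg (Q ^ k) (\<lambda>y. (saw_sum t p (real x + u) + saw_sum t (k * p) (real y
      + w x)) * (block_dev t p x + ?T y)) =
      avg (Q ^ k) (\<lambda>y. saw_sum t p (real x + u) * block_dev t p x + saw_sum t p (real x + u) * ?T y
        + saw_sum t (k * p) (real y + w x) * block_dev t p x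
         + saw_sum t (k * p) (real y + w x) * ?T y)"
      by (intro avg_cong) (simp add: algebra_simps)
    also have "\<dots> = saw_sum t p (real x + u) * block_dev t p x + g x * block_dev t p x
      + avg (Q ^ k) (\<lambda>y. saw_sum t (k * p) (real y + w x) * ?T y)"
      using Q avg_block_sum[OF Q, of "block_dev t p" k] avg_block_dev
      by (simp add: avg_add avg_const avg_mult_left avg_mult_right g_def Q_def)
    also have "\<dots> = (saw_sum t p (real x + u) - saw_sum t p (real x)) * block_dev t p x
      + (block_dev t p x * block_dev t p x + block_mean t p * block_dev t p x)
      + ((g x - m0) * block_dev t p x + m0 * block_dev t p x)
        + avg (Q ^ k) (\<lambda>y. saw_sum t (k * p) (real y + w x) * ?T y)"
      by (simp add: block_dev_def algebra_simps)
    finally show "avg (Q ^ k) (\<lambda>y. (saw_sum t p (real x + u) + saw_sum t (k * p) (real y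
      + w x)) * (block_dev t p x + ?T y)) = \<dots>" .
  qed
  also have "\<dots> = avg Q (\<lambda>x. (saw_sum t p (real x + u) - saw_sum t p (real x)) * block_dev t p x)
    + block_var t p
     + avg Q (\<lambda>x. (g x - m0) * block_dev t p x)
       + avg Q (\<lambda>x. avg (Q ^ k) (\<lambda>y. saw_sum t (k * p) (real y + w x) * ?T y))"
    unfolding avg_add avg_mult_left[of _ "block_mean t p"] avg_mult_left[of _ m0]
    by (simp add: avg_block_dev Q_def block_var_def power2_eq_square)
  finally have eq: "avg (Q ^ Suc k) (\<lambda>n. saw_sum t (Suc k * p) (real n
    + u) * block_sum (block_dev t p) Q (Suc k) n) = \<dots>" .
  have 1: "\<bar>avg Q (\<lambda>x. (saw_sum t p (real x + u) - saw_sum t p (real x)) * block_dev t p x)\<bar>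
    \<le> sqrt (shift_const t * block_var t p)"
    unfolding Q_def by (rule abs_avg_mult_le) (use saw_sum_shift_square_avg_le[OF Suc.prems] in
      \<open>simp_all add: block_var_def\<close>)
  have "(g x - m0)\<^sup>2 \<le> shift_const t" if "x < Q" for x
  proof -
    have "g x - m0 = avg (Q ^ k) (\<lambda>y. (saw_sum t (k * p) (real y + w x)
      - saw_sum t (k * p) (real y)) * 1)"
      by (simp add: g_def m0_def avg_diff)
    then have "(g x - m0)\<^sup>2 \<le> avg (Q ^ k) (\<lambda>y. (saw_sum t (k * p) (real y + w x)
      - saw_sum t (k * p) (real y))\<^sup>2) * avg (Q ^ k) (\<lambda>_. 1\<^sup>2)"
      by (simp only: avg_Cauchy_Schwarz)
    also have "\<dots> \<le> shift_const t"
      using saw_sum_shift_square_avg_le[OF w[OF that], of "k * p" t] q_ge_2 unfolding Qk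
      by (simp add: avg_const)
    finally show ?thesis .
  qed
  then have "avg Q (\<lambda>x. (g x - m0)\<^sup>2) \<le> shift_const t" by (rule avg_le_const[OF Q])
  then have 2: "\<bar>avg Q (\<lambda>x. (g x - m0) * block_dev t p x)\<bar> \<le> sqrt (shift_const t * block_var t p)"
    by (rule abs_avg_mult_le) (simp add: block_var_def Q_def)
  have "avg Q (\<lambda>x. real k * (block_var t p - 2 * sqrt (shift_const t * block_var t p))) \<le>
      avg Q (\<lambda>x. avg (Q ^ k) (\<lambda>y. saw_sum t (k * p) (real y + w x) * ?T y))"
    using Suc.IH w by (intro avg_mono) (simp add: Q_def)
  then have 3: "real k * (block_var t p - 2 * sqrt (shift_const t * block_var t p))
    \<le> avg Q (\<lambda>x. avg (Q ^ k) (\<lambda>y. saw_sum t (k * p) (real y + w x) * ?T y))"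
    using Q by (simp add: avg_const)
  have "real (Suc k) * (block_var t p - 2 * sqrt (shift_const t * block_var t p))
    = real k * (block_var t p - 2 * sqrt (shift_const t * block_var t p)) + block_var t p
      - 2 * sqrt (shift_const t * block_var t p)"
    by (simp add: algebra_simps)
  also have "\<dots> \<le> avg (Q ^ Suc k) (\<lambda>n. saw_sum t (Suc k * p) (real n
    + u) * block_sum (block_dev t p) Q (Suc k) n)"
    unfolding eq using 1 2 3 by linarith
  finally show ?case unfolding Q_def .
qed (simp add: avg_def)

text \<open>Expanding the square, the block sum has second moment exactly
  \<open>real k * block_var t p\<close>, so a lower bound for the cross term is enough.\<close>

lemma avg_saw_sum_minus_block_sum_square_le:
  "avg (q ^ (k * p)) (\<lambda>n. (saw_sum t (k * p) (real n) - block_sum (block_dev t p) (q ^ p) k n)\<^sup>2) \<le>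
    avg (q ^ (k * p)) (\<lambda>n. (saw_sum t (k * p) (real n))\<^sup>2) - real k * block_var t p
      + 4 * real k * sqrt (shift_const t * block_var t p)"
proof -
  have Qk: "q ^ (k * p) = (q ^ p) ^ k" by (simp add: power_mult[symmetric] mult.commute)
  let ?T = "block_sum (block_dev t p) (q ^ p) k" and ?saw_sum = "\<lambda>n. saw_sum t (k * p) (real n)"
  have "avg (q ^ (k * p)) (\<lambda>n. (?saw_sum n - ?T n)\<^sup>2) = avg (q ^ (k * p)) (\<lambda>n. (?saw_sum n)\<^sup>2
    + (?T n)\<^sup>2 - 2 * (?saw_sum n * ?T n))"
    by (intro avg_cong) (simp add: power2_eq_square algebra_simps)
  also have "\<dots> = avg (q ^ (k * p)) (\<lambda>n. (?saw_sum n)\<^sup>2) + avg (q ^ (k * p)) (\<lambda>n. (?T n)\<^sup>2)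
    - 2 * avg (q ^ (k * p)) (\<lambda>n. ?saw_sum n * ?T n)"
    by (simp only: avg_add avg_diff avg_mult_left)
  also have "avg (q ^ (k * p)) (\<lambda>n. (?T n)\<^sup>2) = real k * block_var t p"
    unfolding Qk block_var_def by (rule avg_block_sum_square[OF q_power_pos avg_block_dev])
  finally show ?thesis
    using avg_saw_sum_block_sum_ge[of 0 k t p] by (simp add: Qk algebra_simps)
qed


section \<open>The limit of the characteristic functions\<close>

lemma saw_sum_mod: "saw_sum t M (real n) = saw_sum t M (real (n mod q ^ M))"
proof -
  have "real n = real (n mod q ^ M) + real q ^ M * real (n div q ^ M)"
    by (metis mod_mult_div_eq of_nat_add of_nat_mult of_nat_power)
  then show ?thesis
    using saw_sum_split[of t M 0 "real (n mod q ^ M)" "n div q ^ M"] by (simp add: saw_sum_def)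
qed

text \<open>Legendre's formula is applied to the lowest \<open>M\<close> digits of each
  \<open>A i * n\<close>; there the subtracted mean matches the centring by \<open>1/2\<close>
  exactly. Only boundedly many higher digits remain.\<close>

lemma digit_sums_minus_saw_sum_le:
  assumes "n < q ^ (M + B)"
  shows "\<bar>(\<Sum>i\<in>UNIV. t i * (real (digit_sum q (A i * n)) - (real q - 1) / 2 * real M))
      - saw_sum (\<lambda>i. (real q - 1) * t i) M (real (n mod q ^ M))\<bar> \<le> (\<Sum>i\<in>UNIV. \<bar>t i\<bar> * (1
        + real q * real (B + D)))"
proof -
  have *: "\<bar>real (digit_sum q (A i * n)) - (real q
    - 1) * (\<Sum>l=1..M. frac (real (A i * n) / real q ^ l))\<bar> \<le> 1 + real q * real (B + D)" for i
  proof (rule abs_digit_sum_minus_frac_le[OF q_ge_2])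
    \<comment> \<open>Multiplication by \<open>A i\<close> adds at most \<open>D\<close> digits, a
      crude bound that serves all \<open>i\<close> at once.\<close>
    have "A i \<le> D" using D_pos A_mult_P[of i] by (metis dvd_imp_le dvd_triv_left)
    also have "D < 2 ^ D" by (rule less_exp)
    also have "(2::nat) ^ D \<le> q ^ D" using q_ge_2 by (intro power_mono) auto
    finally have "A i * n \<le> q ^ D * n" by simp
    also have "\<dots> < q ^ D * q ^ (M + B)" using assms q_power_pos by simp
    finally show "A i * n < q ^ (M + (B + D))" by (simp add: power_add ac_simps)
  qed
  have "(\<Sum>i\<in>UNIV. t i * (real (digit_sum q (A i * n)) - (real q - 1) / 2 * real M))
      - saw_sum (\<lambda>i. (real q - 1) * t i) M (real (n mod q ^ M)) =
    (\<Sum>i\<in>UNIV. t i * (real (digit_sum q (A i * n)) - (real q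
      - 1) * (\<Sum>l=1..M. frac (real (A i * n) / real q ^ l))))"
  proof -
    have sub: "(\<Sum>l=1..M. frac (real (A i) * real n / real q ^ l) - 1/2)
      = (\<Sum>l=1..M. frac (real (A i * n) / real q ^ l)) - real M / 2" for i
      by (simp add: sum_subtractf)
    show ?thesis
      unfolding saw_sum_mod[symmetric] unfolding saw_sum_def sub sum_subtractf[symmetric]
      by (intro sum.cong refl) (simp add: field_simps)
  qed
  also have "\<bar>\<dots>\<bar> \<le> (\<Sum>i\<in>UNIV. \<bar>t i\<bar> * (1 + real q * real (B + D)))"
    by (rule order_trans[OF sum_abs sum_mono]) (simp only: abs_mult, intro mult_left_mono *, simp)
  finally show ?thesis .
qed

lemma saw_sum_bounded: "\<bar>saw_sum t p x\<bar> \<le> (\<Sum>i\<in>UNIV. \<bar>t i\<bar> * real p)"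
  unfolding saw_sum_def
proof (rule order_trans[OF sum_abs sum_mono])
  fix i
  have "\<bar>frac y - 1/2\<bar> \<le> 1" for y :: real using frac_lt_1[of y] frac_ge_0[of y] by linarith
  then have "\<bar>\<Sum>l=1..p. frac (real (A i) * x / real q ^ l) - 1/2\<bar> \<le> (\<Sum>l=1..p. 1)"
    by (intro order_trans[OF sum_abs sum_mono])
  then show "\<bar>t i * (\<Sum>l=1..p. frac (real (A i) * x / real q ^ l) - 1/2)\<bar> \<le> \<bar>t i\<bar> * real p"
    unfolding abs_mult by (intro mult_left_mono) auto
qed

abbreviation lg :: "nat \<Rightarrow> real" where "lg N \<equiv> log (real q) (real N)"

text \<open>The characteristic function at \<open>t\<close> of the normalised vector, for uniform
  \<open>n < N\<close>.\<close>

definition \<phi> :: "('d \<Rightarrow> real) \<Rightarrow> nat \<Rightarrow> complex" where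
  "\<phi> t N = avg N (\<lambda>n. cis (\<Sum>i\<in>UNIV. t i * ((real (digit_sum q (A i * n)) - (real q
    - 1) / 2 * lg N) / sqrt (lg N))))"


text \<open>The hypotheses say \<open>q ^ (k * p + c) \<le> N < q ^ (k * p + c + p)\<close>. The
  five terms are the costs, in this order, of replacing digit sums by the sawtooth sum,
  \<open>N\<close> by \<open>q ^ (k * p)\<close>, the sawtooth sum by the block sum, the block sum
  by a Gaussian, and its variance by the limit. The constants \<open>a\<close> and \<open>b\<close>
  do not depend on \<open>N\<close> or \<open>k\<close>.\<close>

lemma \<phi>_error_bound:
  fixes c p :: nat and t :: "'d \<Rightarrow> real"
  defines "t' \<equiv> \<lambda>i. (real q - 1) * t i"
  obtains a b where "\<And>N k. real k * real p \<le> lg N - real c \<Longrightarrow> lg N - real c < (real k + 1) * real p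
    \<Longrightarrow> 1 \<le> lg N \<Longrightarrow> N > 0 \<Longrightarrow>
    cmod (\<phi> t N - exp (- (saw_var t' / 2))) \<le> a / sqrt (lg N) + 2 / real q ^ c
      + sqrt ((avg (q ^ (k * p)) (\<lambda>n. (saw_sum t' (k * p) (real n))\<^sup>2) - real k * block_var t' p
        + 4 * real k * sqrt (shift_const t' * block_var t' p)) / lg N)
      + b * (real k / lg N) / sqrt (lg N) + \<bar>exp (- (block_var t' p * (real k / lg N) / 2))
        - exp (- (saw_var t' / 2))\<bar>"
proof -
  define a where "a = (\<Sum>i\<in>UNIV. \<bar>t i\<bar> * (1 + real q * real (c + p + D)))
    + (\<Sum>i\<in>UNIV. \<bar>t i\<bar> * (real q * real (c + p)))"
  \<comment> \<open>A uniform bound for the deviation of one block, as the Taylor estimate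
    requires.\<close>
  define bb where "bb = (\<Sum>i\<in>UNIV. \<bar>t' i\<bar> * real p) + \<bar>block_mean t' p\<bar>"
  define b where "b = bb ^ 3 + (block_var t' p)\<^sup>2"
  have main: "cmod (\<phi> t N - exp (- (saw_var t' / 2))) \<le> a / sqrt (lg N) + 2 / real q ^ c
      + sqrt ((avg (q ^ (k * p)) (\<lambda>n. (saw_sum t' (k * p) (real n))\<^sup>2) - real k * block_var t' p
        + 4 * real k * sqrt (shift_const t' * block_var t' p)) / lg N)
      + b * (real k / lg N) / sqrt (lg N) + \<bar>exp (- (block_var t' p * (real k / lg N) / 2))
        - exp (- (saw_var t' / 2))\<bar>"
    if k: "real k * real p \<le> lg N - real c" "lg N - real c < (real k + 1) * real p" and N: "1
      \<le> lg N" "N > 0" for N k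
  proof -
    define M where "M = k * p"
    define s where "s = 1 / sqrt (lg N)"
    have s: "0 < s" "s \<le> 1" "s\<^sup>2 = 1 / lg N" using N by (auto simp: s_def power_divide)
    have q1: "real q > 1" using q_ge_2 by simp
    \<comment> \<open>The upper bound leaves at most \<open>c + p\<close> digits above the blocks;
      the lower bound makes an incomplete period a proportion of at most
      \<open>1 / q ^ c\<close>.\<close>
    have NM: "real N < real q ^ (M + (c + p))" "real q ^ M * real q ^ c \<le> real N"
    proof -
      have powN: "real q powr lg N = real N" using q1 N by simp
      have "lg N < real (M + (c + p))" using k by (simp add: M_def algebra_simps)
      then have "real q powr lg N < real q powr real (M + (c + p))" using q1 by simp
      then show "real N < real q ^ (M + (c + p))" unfolding powN using q1
        by (subst (asm) powr_realpow) auto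
      have "real (M + c) \<le> lg N" using k by (simp add: M_def)
      then have "real q powr real (M + c) \<le> real q powr lg N" using q1 by simp
      then show "real q ^ M * real q ^ c \<le> real N" unfolding powN using q1
        by (subst (asm) powr_realpow) (auto simp: power_add)
    qed
    then have Nlt: "N < q ^ (M + (c + p))" by (metis of_nat_less_iff of_nat_power)
    define Z where "Z n = (\<Sum>i\<in>UNIV. t i * (real (digit_sum q (A i * n)) - (real q - 1) / 2 * lg N))"
      for n
    define Fm where "Fm n = saw_sum t' M (real (n mod q ^ M))" for n
    have Zd: "\<bar>Z n - Fm n\<bar> \<le> a" if "n < N" for n
    proof -
      let ?W = "\<Sum>i\<in>UNIV. t i * (real (digit_sum q (A i * n)) - (real q - 1) / 2 * real M)"
      have "\<bar>?W - Fm n\<bar> \<le> (\<Sum>i\<in>UNIV. \<bar>t i\<bar> * (1 + real q * real (c + p + D)))"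
        unfolding Fm_def t'_def using that Nlt by (intro digit_sums_minus_saw_sum_le) simp
      moreover have "Z n - ?W = (\<Sum>i\<in>UNIV. t i * ((real q - 1) / 2 * (real M - lg N)))"
        unfolding Z_def sum_subtractf[symmetric] by (intro sum.cong refl) (simp add: field_simps)
      moreover have "\<bar>\<Sum>i\<in>UNIV. t i * ((real q - 1) / 2 * (real M - lg N))\<bar>
        \<le> (\<Sum>i\<in>UNIV. \<bar>t i\<bar> * (real q * real (c + p)))"
      proof (rule order_trans[OF sum_abs sum_mono])
        fix i
        have "\<bar>real M - lg N\<bar> \<le> real (c + p)" using k by (simp add: M_def algebra_simps abs_le_iff)
        moreover have "\<bar>(real q - 1) / 2\<bar> \<le> real q" using q1 by simp
        ultimately have "\<bar>(real q - 1) / 2\<bar> * \<bar>real M - lg N\<bar> \<le> real q * real (c + p)"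
          by (intro mult_mono) auto
        then show "\<bar>t i * ((real q - 1) / 2 * (real M - lg N))\<bar> \<le> \<bar>t i\<bar> * (real q * real (c + p))"
          unfolding abs_mult by (intro mult_left_mono) auto
      qed
      ultimately show ?thesis unfolding a_def by linarith
    qed
    have \<phi>: "\<phi> t N = avg N (\<lambda>n. cis (s * Z n))"
      unfolding \<phi>_def Z_def s_def sum_distrib_left by (intro avg_cong arg_cong[where f
        = cis] sum.cong refl) simp
    have "cmod (\<phi> t N - avg N (\<lambda>n. cis (s * Fm n))) \<le> avg N (\<lambda>n. cmod (cis (s * Z n)
      - cis (s * Fm n)))"
      unfolding \<phi> avg_diff[symmetric] by (rule norm_avg_le)
    also have "\<dots> \<le> s * a"
    proof (rule avg_le_const[OF \<open>N > 0\<close>])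
      fix n assume "n < N"
      have "cmod (cis (s * Z n) - cis (s * Fm n)) \<le> \<bar>s * Z n - s * Fm n\<bar>" by (rule cmod_cis_diff_le)
      also have "\<dots> = s * \<bar>Z n - Fm n\<bar>" using s by (simp add: abs_mult flip: right_diff_distrib)
      also have "\<dots> \<le> s * a" using s Zd[OF \<open>n < N\<close>] by simp
      finally show "cmod (cis (s * Z n) - cis (s * Fm n)) \<le> s * a" .
    qed
    finally have 1: "cmod (\<phi> t N - avg N (\<lambda>n. cis (s * Fm n))) \<le> a / sqrt (lg N)"
      by (simp add: s_def)
    have "cmod (avg N (\<lambda>n. cis (s * Fm n)) - avg (q ^ M) (\<lambda>n. cis (s * saw_sum t' M (real n))))
      \<le> 2 * real (q ^ M) / real N"
      unfolding Fm_def using N q_power_pos by (intro cmod_avg_mod_diff_le) auto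
    also have "\<dots> \<le> 2 / real q ^ c"
      using NM(2) N q1 by (simp add: field_simps)
    finally have 2: "cmod (avg N (\<lambda>n. cis (s * Fm n))
      - avg (q ^ M) (\<lambda>n. cis (s * saw_sum t' M (real n)))) \<le> 2 / real q ^ c" .
    let ?T = "block_sum (block_dev t' p) (q ^ p) k"
    let ?R = "avg (q ^ (k * p)) (\<lambda>n. (saw_sum t' (k * p) (real n))\<^sup>2) - real k * block_var t' p
      + 4 * real k * sqrt (shift_const t' * block_var t' p)"
    have "cmod (avg (q ^ M) (\<lambda>n. cis (s * saw_sum t' M (real n)))
      - avg (q ^ M) (\<lambda>n. cis (s * ?T n)))
        \<le> \<bar>s\<bar> * sqrt (avg (q ^ M) (\<lambda>n. (saw_sum t' M (real n) - ?T n)\<^sup>2))"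
      by (rule cmod_avg_cis_diff_le)
    also have "\<dots> \<le> \<bar>s\<bar> * sqrt ?R"
      unfolding M_def by (intro mult_left_mono real_sqrt_le_mono
        avg_saw_sum_minus_block_sum_square_le) simp
    also have "\<dots> = sqrt (?R / lg N)" using s N by (simp add: s_def real_sqrt_divide)
    finally have 3: "cmod (avg (q ^ M) (\<lambda>n. cis (s * saw_sum t' M (real n)))
      - avg (q ^ M) (\<lambda>n. cis (s * ?T n))) \<le> sqrt (?R / lg N)" .
    have "q ^ M = (q ^ p) ^ k" by (simp add: M_def power_mult[symmetric] mult.commute)
    moreover have "\<bar>block_dev t' p n\<bar> \<le> bb" for n
      unfolding block_dev_def bb_def using saw_sum_bounded[of t' p "real n"] by linarith
    ultimately have "cmod (avg (q ^ M) (\<lambda>n. cis (s * ?T n))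
      - exp (- (block_var t' p * (real k * s\<^sup>2) / 2))) \<le> real k * ((bb ^ 3
        + (block_var t' p)\<^sup>2) * \<bar>s\<bar> ^ 3)"
      using cmod_avg_cis_block_sum_le[OF q_power_pos avg_block_dev, of p t' bb s k] s
      by (simp add: block_var_def)
    also have "\<dots> = b * (real k / lg N) / sqrt (lg N)"
      using s N by (simp add: b_def power3_eq_cube power2_eq_square s_def)
    finally have 4: "cmod (avg (q ^ M) (\<lambda>n. cis (s * ?T n))
      - exp (- (block_var t' p * (real k / lg N) / 2))) \<le> b * (real k / lg N) / sqrt (lg N)"
      using s by simp
    have 5: "cmod (complex_of_real (exp (- (block_var t' p * (real k / lg N) / 2)))
      - exp (- (saw_var t' / 2))) = \<bar>exp (- (block_var t' p * (real k / lg N) / 2))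
        - exp (- (saw_var t' / 2))\<bar>"
      by (metis norm_of_real of_real_diff real_norm_def)
    have tri: "cmod (x0 - x5) \<le> cmod (x0 - x1) + cmod (x1 - x2) + cmod (x2 - x3) + cmod (x3 - x4)
      + cmod (x4 - x5)" for x0 x1 x2 x3 x4 x5
      by norm
    show ?thesis
      using tri[of "\<phi> t N" "complex_of_real (exp (- (saw_var t' / 2)))" "avg N (\<lambda>n. cis (s * Fm n))"
        "avg (q ^ M) (\<lambda>n. cis (s * saw_sum t' M (real n)))"
         "avg (q ^ M) (\<lambda>n. cis (s * ?T n))" "complex_of_real (exp (- (block_var t' p * (real k / lg
           N) / 2)))"]
        1 2 3 4 5 by linarith
  qed
  show ?thesis by (rule that[of a b]) (rule main)
qed

lemma lg_at_top: "filterlim lg at_top sequentially"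
proof -
  have "filterlim (\<lambda>N. 1 / ln (real q) * ln (real N)) at_top sequentially"
    using q_ge_2
    by (intro filterlim_tendsto_pos_mult_at_top[OF tendsto_const] filterlim_compose[OF ln_at_top]
      filterlim_real_sequentially) auto
  then show ?thesis by (simp add: log_def)
qed

text \<open>The parameters are fixed in order: the block length \<open>p\<close> makes the block
  approximation good, then \<open>c\<close> makes incomplete periods rare, and finally the number
  \<open>k N\<close> of blocks grows with \<open>N\<close>.\<close>

lemma \<phi>_limit: "\<phi> t \<longlonglongrightarrow> of_real (exp (- (saw_var (\<lambda>i. (real q - 1) * t i) / 2)))"
proof (rule tendstoI)
  fix \<epsilon> :: real assume \<epsilon>: "\<epsilon> > 0"
  define t' where "t' = (\<lambda>i. (real q - 1) * t i)"
  \<comment> \<open>What remains of the third and fifth error terms as \<open>N\<close> grows with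
    \<open>p\<close> fixed, when \<open>real (k N) / lg N\<close> tends to
    \<open>1 / real p\<close>.\<close>
  define \<beta> where "\<beta> p = sqrt ((saw_var t' * real p - block_var t' p
    + 4 * sqrt (shift_const t' * block_var t' p)) * (1 / real p))
     + \<bar>exp (- (block_var t' p * (1 / real p) / 2)) - exp (- (saw_var t' / 2))\<bar>" for p
  \<comment> \<open>Since \<open>block_var t' p / real p\<close> tends to \<open>saw_var t'\<close>,
    the first two terms under the root cancel in the limit and the third is of order
    \<open>1 / sqrt p\<close>.\<close>
  have "\<beta> \<longlonglongrightarrow> 0"
  proof -
    have "(\<lambda>p. sqrt (saw_var t' - block_var t' p / real p
      + 4 * sqrt (shift_const t' * (block_var t' p / real p) * (1 / real p)))
       + \<bar>exp (- (block_var t' p / real p / 2)) - exp (- (saw_var t' / 2))\<bar>)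
      \<longlonglongrightarrow> sqrt (saw_var t' - saw_var t' + 4 * sqrt (shift_const t' * saw_var t' * 0))
        + \<bar>exp (- (saw_var t' / 2)) - exp (- (saw_var t' / 2))\<bar>"
      by (intro tendsto_intros block_var_limit lim_const_over_n) auto
    then have "(\<lambda>p. sqrt (saw_var t' - block_var t' p / real p
      + 4 * sqrt (shift_const t' * (block_var t' p / real p) * (1 / real p)))
       + \<bar>exp (- (block_var t' p / real p / 2)) - exp (- (saw_var t' / 2))\<bar>) \<longlonglongrightarrow> 0" by simp
    then show ?thesis
    proof (rule Lim_transform_eventually)
      show "\<forall>\<^sub>F p in sequentially. sqrt (saw_var t' - block_var t' p / real p
        + 4 * sqrt (shift_const t' * (block_var t' p / real p) * (1 / real p)))
       + \<bar>exp (- (block_var t' p / real p / 2)) - exp (- (saw_var t' / 2))\<bar> = \<beta> p"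
      proof (rule eventually_sequentiallyI[of 1])
        fix p :: nat assume p: "1 \<le> p"
        have "sqrt (shift_const t' * (block_var t' p / real p) * (1 / real p))
          = sqrt (shift_const t' * block_var t' p) / real p"
          using p by (simp add: real_sqrt_divide)
        then have "saw_var t' - block_var t' p / real p
          + 4 * sqrt (shift_const t' * (block_var t' p / real p) * (1 / real p)) =
           (saw_var t' * real p - block_var t' p + 4 * sqrt (shift_const t' * block_var t' p)) * (1
             / real p)"
          using p by (simp add: field_simps)
        then show "sqrt (saw_var t' - block_var t' p / real p
          + 4 * sqrt (shift_const t' * (block_var t' p / real p) * (1 / real p)))
          + \<bar>exp (- (block_var t' p / real p / 2)) - exp (- (saw_var t' / 2))\<bar> = \<beta> p"
          by (simp add: \<beta>_def)
      qed
    qed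
  qed
  then have "\<forall>\<^sub>F p in sequentially. \<beta> p < \<epsilon> / 2"
    by (rule order_tendstoD) (use \<epsilon> in simp)
  then obtain p where p: "p \<ge> 1" "\<beta> p < \<epsilon> / 2"
    by (metis (no_types, lifting) eventually_sequentially nat_le_linear)
  obtain c where c: "2 / real q ^ c < \<epsilon> / 2"
  proof -
    have "(\<lambda>c. 2 * (1 / real q) ^ c) \<longlonglongrightarrow> 2 * 0"
      using q_ge_2 by (intro tendsto_mult tendsto_const LIMSEQ_power_zero) auto
    then have "(\<lambda>c. 2 * (1 / real q) ^ c) \<longlonglongrightarrow> 0" by simp
    then have "\<forall>\<^sub>F c in sequentially. 2 * (1 / real q) ^ c < \<epsilon> / 2"
      by (rule order_tendstoD) (use \<epsilon> in simp)
    then obtain c where "2 * (1 / real q) ^ c < \<epsilon> / 2" by (auto simp: eventually_sequentially)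
    then show ?thesis by (intro that[of c]) (simp add: power_divide)
  qed
  obtain a b where ab: "\<And>N k. real k * real p \<le> lg N - real c \<Longrightarrow> lg N - real c < (real k
    + 1) * real p \<Longrightarrow> 1 \<le> lg N \<Longrightarrow> N > 0 \<Longrightarrow>
    cmod (\<phi> t N - exp (- (saw_var t' / 2))) \<le> a / sqrt (lg N) + 2 / real q ^ c
      + sqrt ((avg (q ^ (k * p)) (\<lambda>n. (saw_sum t' (k * p) (real n))\<^sup>2) - real k * block_var t' p
        + 4 * real k * sqrt (shift_const t' * block_var t' p)) / lg N)
      + b * (real k / lg N) / sqrt (lg N) + \<bar>exp (- (block_var t' p * (real k / lg N) / 2))
        - exp (- (saw_var t' / 2))\<bar>"
    using \<phi>_error_bound[of p c t] unfolding t'_def by metis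
  define G where "G b = avg (q ^ b) (\<lambda>n. (saw_sum t' b (real n))\<^sup>2) / real b" for b
  \<comment> \<open>The largest number of blocks that leaves at least \<open>c\<close> digits above
    them. For \<open>lg N < real c\<close> the value defaults to 0, so the bounds \<open>kb\<close>
    require \<open>lg N\<close> to be large.\<close>
  define k where "k N = nat \<lfloor>(lg N - real c) / real p\<rfloor>" for N
  have k_at_top: "filterlim k at_top sequentially"
  proof -
    have "filterlim (\<lambda>N. (lg N - real c) / real p) at_top sequentially"
    proof -
      have "filterlim (\<lambda>N. 1 / real p * (- real c + lg N)) at_top sequentially"
        using p by (intro filterlim_tendsto_pos_mult_at_top[OF tendsto_const]
          filterlim_tendsto_add_at_top[OF tendsto_const] lg_at_top) auto
      then show ?thesis by (simp add: diff_divide_distrib add_divide_distrib)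
    qed
    then show ?thesis unfolding k_def
      by (intro filterlim_compose[OF filterlim_nat_sequentially] filterlim_compose[OF
        filterlim_floor_sequentially])
  qed
  have lg_ge: "\<forall>\<^sub>F N in sequentially. lg N \<ge> max 1 (real c)"
    using lg_at_top unfolding filterlim_at_top by (rule spec)
  have kb: "real (k N) * real p \<le> lg N - real c" "lg N - real c < (real (k N) + 1) * real p"
    if "lg N \<ge> max 1 (real c)" for N
  proof -
    have "0 \<le> (lg N - real c) / real p" using that by simp
    then have "real (k N) = of_int \<lfloor>(lg N - real c) / real p\<rfloor>" unfolding k_def by simp
    then have "real (k N) \<le> (lg N - real c) / real p" "(lg N - real c) / real p < real (k N) + 1"
      by linarith+
    then show "real (k N) * real p \<le> lg N - real c" "lg N - real c < (real (k N) + 1) * real p"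
      using p by (simp_all add: field_simps)
  qed
  have inv_lg: "(\<lambda>N. 1 / lg N) \<longlonglongrightarrow> 0"
    by (intro tendsto_divide_0[OF tendsto_const] filterlim_at_top_imp_at_infinity lg_at_top)
  have inv_sqrt_lg: "(\<lambda>N. 1 / sqrt (lg N)) \<longlonglongrightarrow> 0"
    by (intro tendsto_divide_0[OF tendsto_const] filterlim_at_top_imp_at_infinity
      filterlim_compose[OF sqrt_at_top lg_at_top])
  have ratio: "(\<lambda>N. real (k N) / lg N) \<longlonglongrightarrow> 1 / real p"
  proof (rule tendsto_sandwich)
    show "\<forall>\<^sub>F N in sequentially. (1 - real c * (1 / lg N)) / real p - 1 / lg N \<le> real (k N) / lg N"
      using lg_ge
    proof eventually_elim
      case (elim N)
      have "(lg N - real c) / real p - 1 \<le> real (k N)" using kb[OF elim] p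
        by (simp add: field_simps)
      then have "((lg N - real c) / real p - 1) / lg N \<le> real (k N) / lg N"
        using elim by (intro divide_right_mono) auto
      moreover have "((lg N - real c) / real p - 1) / lg N = (1 - real c * (1 / lg N)) / real p
        - 1 / lg N"
        using elim p by (simp add: field_simps)
      ultimately show ?case by simp
    qed
    show "\<forall>\<^sub>F N in sequentially. real (k N) / lg N \<le> 1 / real p"
      using lg_ge
    proof eventually_elim
      case (elim N)
      have "real (k N) * real p \<le> lg N" using kb(1)[OF elim] by linarith
      then show ?case using elim p by (simp add: field_simps)
    qed
    have "(\<lambda>N. (1 - real c * (1 / lg N)) / real p - 1 / lg N) \<longlonglongrightarrow> (1 - real c * 0) / real p - 0"
      using p by (intro tendsto_intros inv_lg) auto
    then show "(\<lambda>N. (1 - real c * (1 / lg N)) / real p - 1 / lg N) \<longlonglongrightarrow> 1 / real p" by simp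
  qed simp
  have G: "(\<lambda>N. G (k N * p)) \<longlonglongrightarrow> saw_var t'"
  proof -
    have "filterlim (\<lambda>N. k N * p) at_top sequentially"
    proof (rule filterlim_at_top_mono[OF k_at_top])
      show "\<forall>\<^sub>F N in sequentially. k N \<le> k N * p" using p by (intro always_eventually) auto
    qed
    with saw_sum_square_limit[of t'] show ?thesis unfolding G_def by (rule filterlim_compose)
  qed
  define bound where "bound N = a * (1 / sqrt (lg N)) + 2 / real q ^ c
      + sqrt ((G (k N * p) * real p - block_var t' p
        + 4 * sqrt (shift_const t' * block_var t' p)) * (real (k N) / lg N))
      + b * (real (k N) / lg N) * (1 / sqrt (lg N))
        + \<bar>exp (- (block_var t' p * (real (k N) / lg N) / 2)) - exp (- (saw_var t' / 2))\<bar>" for N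
  have "bound \<longlonglongrightarrow> a * 0 + 2 / real q ^ c
      + sqrt ((saw_var t' * real p - block_var t' p
        + 4 * sqrt (shift_const t' * block_var t' p)) * (1 / real p))
      + b * (1 / real p) * 0 + \<bar>exp (- (block_var t' p * (1 / real p) / 2))
        - exp (- (saw_var t' / 2))\<bar>"
    unfolding bound_def by (intro tendsto_intros G ratio inv_sqrt_lg) auto
  then have "bound \<longlonglongrightarrow> 2 / real q ^ c + \<beta> p" by (simp add: \<beta>_def add.assoc)
  then have "\<forall>\<^sub>F N in sequentially. bound N < \<epsilon>"
    by (rule order_tendstoD) (use c p in linarith)
  moreover have "\<forall>\<^sub>F N in sequentially. k N > 0"
    using spec[OF k_at_top[unfolded filterlim_at_top], of 1] by (simp add: Suc_le_eq)
  ultimately show "\<forall>\<^sub>F N in sequentially. dist (\<phi> t N) (of_real (exp (- (saw_var (\<lambda>i. (real q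
    - 1) * t i) / 2)))) < \<epsilon>"
    using lg_ge eventually_gt_at_top[of 0]
  proof eventually_elim
    case (elim N)
    have "cmod (\<phi> t N - exp (- (saw_var t' / 2))) \<le> a / sqrt (lg N) + 2 / real q ^ c
      + sqrt ((avg (q ^ (k N * p)) (\<lambda>n. (saw_sum t' (k N * p) (real n))\<^sup>2)
        - real (k N) * block_var t' p + 4 * real (k N) * sqrt (shift_const t' * block_var t' p)) /
          lg N)
      + b * (real (k N) / lg N) / sqrt (lg N) + \<bar>exp (- (block_var t' p * (real (k N) / lg N) / 2))
        - exp (- (saw_var t' / 2))\<bar>"
      using elim kb[OF elim(3)] by (intro ab) auto
    also have "(avg (q ^ (k N * p)) (\<lambda>n. (saw_sum t' (k N * p) (real n))\<^sup>2)
      - real (k N) * block_var t' p + 4 * real (k N) * sqrt (shift_const t' * block_var t' p)) / lg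
        N
      = (G (k N * p) * real p - block_var t' p + 4 * sqrt (shift_const t' * block_var t' p)) * (real
        (k N) / lg N)"
      using elim p by (simp add: G_def field_simps)
    finally have "cmod (\<phi> t N - exp (- (saw_var t' / 2))) \<le> bound N" by (simp add: bound_def)
    with elim(1) show ?case by (simp add: dist_norm t'_def)
  qed
qed

end

section \<open>Weak convergence from characteristic functions\<close>

text \<open>The phase \<open>a\<close> brings in sines and constants, so real functions
  suffice.\<close>

inductive trig_poly :: "('a::real_inner \<Rightarrow> real) \<Rightarrow> bool" where
  cos: "trig_poly (\<lambda>x. c * cos (t \<bullet> x + a))"
| add: "trig_poly f \<Longrightarrow> trig_poly g \<Longrightarrow> trig_poly (\<lambda>x. f x + g x)"

lemma trig_poly_const: "trig_poly (\<lambda>x. c)"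
  using trig_poly.cos[of c 0 0] by simp

lemma trig_poly_mult:
  assumes "trig_poly f" "trig_poly g"
  shows "trig_poly (\<lambda>x. f x * g x)"
  using assms(1)
proof induction
  case (cos c t a)
  show ?case using assms(2)
  proof induction
    case (cos c' t' a')
    have "c * cos (t \<bullet> x + a) * (c' * cos (t' \<bullet> x + a')) =
      c * c' / 2 * cos ((t - t') \<bullet> x + (a - a')) + c * c' / 2 * cos ((t + t') \<bullet> x + (a + a'))" for x
    proof -
      have "cos (t \<bullet> x + a) * cos (t' \<bullet> x + a') = (cos ((t - t') \<bullet> x + (a - a')) + cos ((t + t') \<bullet> x
        + (a + a'))) / 2"
        unfolding cos_times_cos by (simp add: inner_diff_left inner_add_left algebra_simps)
      then show ?thesis by (simp add: field_simps)
    qed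
    then show ?case by (simp only:) (intro trig_poly.intros)
  next
    case (add f g)
    then show ?case by (simp only: distrib_left) (rule trig_poly.add)
  qed
next
  case (add f g)
  then show ?case by (simp only: distrib_right) (rule trig_poly.add)
qed

lemma trig_poly_sum: "finite I \<Longrightarrow> (\<And>i. i \<in> I \<Longrightarrow> trig_poly (f i)) \<Longrightarrow> trig_poly (\<lambda>x. \<Sum>i\<in>I. f i x)"
  by (induction I rule: finite_induct) (auto intro: trig_poly_const trig_poly.add)

text \<open>Folds the whole space into the cube with coordinates in \<open>[-1, 1]\<close>, so that
  polynomials of the image are bounded everywhere.\<close>

definition fold_sin :: "real \<Rightarrow> 'a::euclidean_space \<Rightarrow> 'a" where
  "fold_sin T x = (\<Sum>b\<in>Basis. sin (x \<bullet> b / T) *\<^sub>R b)"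

text \<open>A sine is a cosine with phase \<open>- pi / 2\<close>, which settles linear functions;
  sums and products are covered by closure.\<close>

lemma trig_poly_polynomial_fold_sin:
  fixes g :: "'a::euclidean_space \<Rightarrow> real"
  assumes "real_polynomial_function g"
  shows "trig_poly (\<lambda>x. g (fold_sin T x))"
  using assms
proof induction
  case (linear f)
  interpret bounded_linear f by fact
  have "f (fold_sin T x) = (\<Sum>b\<in>Basis. f b * cos ((b /\<^sub>R T) \<bullet> x + (- (pi / 2))))" for x
  proof -
    have "(b /\<^sub>R T) \<bullet> x = x \<bullet> b / T" for b
      by (simp add: inner_commute divide_inverse)
    moreover have "cos (y + (- (pi / 2))) = sin y" for y :: real
      by (simp add: cos_diff)
    moreover have "f (fold_sin T x) = (\<Sum>b\<in>Basis. sin (x \<bullet> b / T) * f b)"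
      by (simp add: fold_sin_def sum scaleR)
    ultimately show ?thesis by (simp only: mult.commute)
  qed
  then have eq: "(\<lambda>x. f (fold_sin T x)) = (\<lambda>x. \<Sum>b\<in>Basis. f b * cos ((b /\<^sub>R T) \<bullet> x + (- (pi / 2))))"
    by (rule ext)
  show ?case unfolding eq by (intro trig_poly_sum trig_poly.cos finite_Basis)
qed (auto intro: trig_poly_const trig_poly.add trig_poly_mult)

lemma fold_sin_in_cbox: "fold_sin T x \<in> cbox (- One) One"
  by (auto simp: mem_box fold_sin_def inner_sum_left inner_Basis if_distrib sum.If_cases cong:
    if_cong)

text \<open>A cosine with a phase is the real part of \<open>cis a * cis (t \<bullet> x)\<close>, so
  its integral is read off from the characteristic function. Integrability is carried along for the
  additive step.\<close>

lemma trig_poly_integral_tendsto: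
  fixes M :: "nat \<Rightarrow> 'a::euclidean_space measure"
  assumes M: "\<And>n. prob_space (M n)" "\<And>n. sets (M n) = sets borel"
    and \<mu>: "prob_space \<mu>" "sets \<mu> = sets borel"
    and conv: "\<And>t. (\<lambda>n. \<integral>x. cis (t \<bullet> x) \<partial>M n) \<longlonglongrightarrow> (\<integral>x. cis (t \<bullet> x) \<partial>\<mu>)"
    and f: "trig_poly f"
  shows "(\<forall>n. integrable (M n) f) \<and> integrable \<mu> f \<and> (\<lambda>n. \<integral>x. f x \<partial>M n) \<longlonglongrightarrow> (\<integral>x. f x \<partial>\<mu>)"
  using f
proof induction
  case (cos c t a)
  have *: "integrable \<nu> (\<lambda>x. c * cos (t \<bullet> x + a)) \<and>
      (\<integral>x. c * cos (t \<bullet> x + a) \<partial>\<nu>) = c * Re (cis a * (\<integral>x. cis (t \<bullet> x) \<partial>\<nu>))"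
    if \<nu>: "prob_space \<nu>" "sets \<nu> = sets borel" for \<nu> :: "'a measure"
  proof -
    interpret prob_space \<nu> by fact
    note [measurable_cong] = \<nu>(2)
    have i: "integrable \<nu> (\<lambda>x. cis (t \<bullet> x))"
      by (rule integrable_const_bound[of _ 1])
        (auto intro!: borel_measurable_continuous_onI continuous_intros simp:
          measurable_cong_sets[OF \<nu>(2) refl])
    then have i2: "integrable \<nu> (\<lambda>x. cis a * cis (t \<bullet> x))" by (rule integrable_mult_right)
    have "integrable \<nu> (\<lambda>x. Re (cis a * cis (t \<bullet> x)))" using i2 by (rule integrable_Re)
    moreover have "(\<integral>x. Re (cis a * cis (t \<bullet> x)) \<partial>\<nu>) = Re (cis a * (\<integral>x. cis (t \<bullet> x) \<partial>\<nu>))"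
      using integral_Re[OF i2] i by simp
    moreover have "Re (cis a * cis (t \<bullet> x)) = cos (t \<bullet> x + a)" for x
      by (simp add: cis_mult add.commute)
    ultimately show ?thesis by simp
  qed
  show ?case
  proof (intro conjI allI)
    have "(\<lambda>n. c * Re (cis a * (\<integral>x. cis (t \<bullet> x) \<partial>M n))) \<longlonglongrightarrow> c * Re (cis a * (\<integral>x. cis (t \<bullet> x) \<partial>\<mu>))"
      by (intro tendsto_intros conv)
    then show "(\<lambda>n. \<integral>x. c * cos (t \<bullet> x + a) \<partial>M n) \<longlonglongrightarrow> (\<integral>x. c * cos (t \<bullet> x + a) \<partial>\<mu>)"
      by (simp only: conjunct2[OF *[OF M]] conjunct2[OF *[OF \<mu>]])
  qed (rule conjunct1[OF *[OF M]], rule conjunct1[OF *[OF \<mu>]])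
next
  case (add f g)
  then show ?case by (auto intro!: tendsto_add)
qed

section \<open>Tightness and weak convergence\<close>

text \<open>A continuous substitute for the indicator of a tail: 0 while the absolute value of
  \<open>y\<close> is at most \<open>R\<close>, and 1 from \<open>R + 1\<close> on (for
  \<open>R\<close> nonnegative).\<close>

definition ramp :: "real \<Rightarrow> real \<Rightarrow> real" where
  "ramp R y = min 1 (max 0 (\<bar>y\<bar> - R))"

lemma ramp_range: "0 \<le> ramp R y" "ramp R y \<le> 1" by (auto simp: ramp_def)

lemma continuous_ramp [continuous_intros]: "continuous_on S f \<Longrightarrow> continuous_on S (\<lambda>x. ramp R (f x))"
  unfolding ramp_def by (intro continuous_intros)

text \<open>The ramp sees only the projection to \<open>b\<close>, whose characteristic function is
  the given one along the line through \<open>b\<close>. The one-dimensional continuity theorem of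
  Levy applies to it.\<close>

lemma ramp_integral_tendsto:
  fixes M :: "nat \<Rightarrow> 'a::euclidean_space measure"
  assumes M: "\<And>n. prob_space (M n)" "\<And>n. sets (M n) = sets borel"
    and \<mu>: "prob_space \<mu>" "sets \<mu> = sets borel"
    and conv: "\<And>t. (\<lambda>n. \<integral>x. cis (t \<bullet> x) \<partial>M n) \<longlonglongrightarrow> (\<integral>x. cis (t \<bullet> x) \<partial>\<mu>)"
  shows "(\<lambda>n. \<integral>x. ramp R (x \<bullet> b) \<partial>M n) \<longlonglongrightarrow> (\<integral>x. ramp R (x \<bullet> b) \<partial>\<mu>)"
proof -
  have meas: "(\<lambda>x. x \<bullet> b) \<in> borel_measurable \<nu>" if "sets \<nu> = sets borel" for \<nu> :: "'a measure"
    by (simp add: measurable_cong_sets[OF that refl])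
  have rd: "real_distribution (distr \<nu> borel (\<lambda>x. x \<bullet> b))"
    if "prob_space \<nu>" "sets \<nu> = sets borel" for \<nu> :: "'a measure"
    using prob_space.real_distribution_distr[OF that(1) meas[OF that(2)]] .
  have ch: "char (distr \<nu> borel (\<lambda>x. x \<bullet> b)) s = (\<integral>x. cis ((s *\<^sub>R b) \<bullet> x) \<partial>\<nu>)"
    if "sets \<nu> = sets borel" for \<nu> :: "'a measure" and s
    unfolding char_def by (subst integral_distr[OF meas[OF that]]) (auto simp: cis_conv_exp
      inner_commute)
  have wc: "weak_conv_m (\<lambda>n. distr (M n) borel (\<lambda>x. x \<bullet> b)) (distr \<mu> borel (\<lambda>x. x \<bullet> b))"
    by (rule levy_continuity) (simp_all only: rd M \<mu> ch conv)
  have "(\<lambda>n. \<integral>y. ramp R y \<partial>distr (M n) borel (\<lambda>x. x \<bullet> b))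
    \<longlonglongrightarrow> (\<integral>y. ramp R y \<partial>distr \<mu> borel (\<lambda>x. x \<bullet> b))"
  proof (rule weak_conv_imp_integral_bdd_continuous_conv[OF _ _ wc])
    show "isCont (ramp R) y" for y
      using continuous_ramp[OF continuous_on_id, of UNIV R]
      by (simp add: continuous_on_eq_continuous_at)
    show "norm (ramp R y) \<le> 1" for y using ramp_range[of R y] by simp
  qed (auto simp: rd M \<mu>)
  moreover have [measurable]: "ramp R \<in> borel_measurable borel"
    using continuous_ramp[OF continuous_on_id, of UNIV R]
    by (simp add: borel_measurable_continuous_onI)
  ultimately show ?thesis
    by (simp add: integral_distr meas M \<mu>)
qed

lemma ramp_integral_vanishes:
  fixes \<mu> :: "'a::euclidean_space measure"
  assumes \<mu>: "prob_space \<mu>" "sets \<mu> = sets borel"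
  shows "(\<lambda>R. \<integral>x. ramp (real R) (x \<bullet> b) \<partial>\<mu>) \<longlonglongrightarrow> 0"
proof -
  interpret prob_space \<mu> by fact
  have "(\<lambda>R. \<integral>x. ramp (real R) (x \<bullet> b) \<partial>\<mu>) \<longlonglongrightarrow> (\<integral>x. 0 \<partial>\<mu>)"
  proof (rule integral_dominated_convergence[where w = "\<lambda>_. 1"])
    show "(\<lambda>x. ramp (real R) (x \<bullet> b)) \<in> borel_measurable \<mu>" for R
      by (auto intro!: borel_measurable_continuous_onI continuous_intros simp:
        measurable_cong_sets[OF \<mu>(2) refl])
    show "AE x in \<mu>. (\<lambda>R. ramp (real R) (x \<bullet> b)) \<longlonglongrightarrow> 0"
    proof (intro AE_I2)
      fix x
      obtain R0 where R0: "\<bar>x \<bullet> b\<bar> < real R0" using reals_Archimedean2 by blast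
      have "\<forall>\<^sub>F R in sequentially. ramp (real R) (x \<bullet> b) = 0"
        by (rule eventually_sequentiallyI[of R0]) (use R0 in \<open>auto simp: ramp_def\<close>)
      then show "(\<lambda>R. ramp (real R) (x \<bullet> b)) \<longlonglongrightarrow> 0" by (rule tendsto_eventually)
    qed
  qed (auto simp: ramp_range)
  then show ?thesis by simp
qed

text \<open>On a large box a trigonometric polynomial \<open>h\<close> is uniformly close to
  \<open>f\<close>; off the box the error is bounded and is charged to the ramps, whose integrals
  converge to a small limit.\<close>

theorem converges_in_law_if_characteristic_functions_converge:
  fixes M :: "nat \<Rightarrow> 'a::euclidean_space measure"
  assumes M: "\<And>n. prob_space (M n)" "\<And>n. sets (M n) = sets borel"
    and \<mu>: "prob_space \<mu>" "sets \<mu> = sets borel"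
    and conv: "\<And>t. (\<lambda>n. \<integral>x. cis (t \<bullet> x) \<partial>M n) \<longlonglongrightarrow> (\<integral>x. cis (t \<bullet> x) \<partial>\<mu>)"
  shows "converges_in_law M \<mu>"
  unfolding converges_in_law_def
proof (intro allI impI, elim conjE)
  fix f :: "'a \<Rightarrow> real" assume f: "continuous_on UNIV f" and "bounded (range f)"
  then obtain B where B: "\<And>x. \<bar>f x\<bar> \<le> B" by (auto simp: bounded_iff)
  then have B0: "B \<ge> 0" using abs_ge_zero order_trans by blast
  show "(\<lambda>n. \<integral>x. f x \<partial>M n) \<longlonglongrightarrow> (\<integral>x. f x \<partial>\<mu>)"
  proof (rule tendstoI)
    fix \<epsilon> :: real assume \<epsilon>: "\<epsilon> > 0"
    \<comment> \<open>Each of the two laws costs less than \<open>2 * \<delta>\<close> for replacing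
      \<open>f\<close> by \<open>h\<close>, and the integrals of \<open>h\<close> differ by less
      than \<delta>; this makes 5. The cap at 1 gives the bound \<open>2 * B + 1\<close> off the
      box.\<close>
    define \<delta> where "\<delta> = min 1 (\<epsilon> / 5)"
    have \<delta>: "0 < \<delta>" "\<delta> \<le> 1" "5 * \<delta> \<le> \<epsilon>" using \<epsilon> by (auto simp: \<delta>_def)
    define tail where "tail R x = (\<Sum>b\<in>Basis. ramp R (x \<bullet> b))" for R and x :: 'a
    have tail_int: "integrable \<nu> (tail R)" "integrable \<nu> (\<lambda>x. ramp R (x \<bullet> b))"
      if "prob_space \<nu>" "sets \<nu> = sets borel" for \<nu> R b
    proof -
      interpret prob_space \<nu> by fact
      show i: "integrable \<nu> (\<lambda>x. ramp R (x \<bullet> b))" for b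
        by (rule integrable_const_bound[of _ 1])
          (auto intro!: borel_measurable_continuous_onI continuous_intros simp: ramp_range
            measurable_cong_sets[OF that(2) refl])
      show "integrable \<nu> (tail R)" unfolding tail_def[abs_def]
        by (intro Bochner_Integration.integrable_sum i)
    qed
    have tail_eq: "(\<integral>x. tail R x \<partial>\<nu>) = (\<Sum>b\<in>Basis. \<integral>x. ramp R (x \<bullet> b) \<partial>\<nu>)"
      if "prob_space \<nu>" "sets \<nu> = sets borel" for \<nu> R
      unfolding tail_def by (rule Bochner_Integration.integral_sum) (rule tail_int(2)[OF that])
    have "(\<lambda>R. (2 * B + 1) * (\<integral>x. tail (real R) x \<partial>\<mu>)) \<longlonglongrightarrow> (2 * B + 1) * (\<Sum>b\<in>(Basis::'a set). 0)"
      unfolding tail_eq[OF \<mu>] by (intro tendsto_mult tendsto_const tendsto_sum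
        ramp_integral_vanishes \<mu>)
    then have "(\<lambda>R. (2 * B + 1) * (\<integral>x. tail (real R) x \<partial>\<mu>)) \<longlonglongrightarrow> 0" by simp
    then have "\<forall>\<^sub>F R in sequentially. (2 * B + 1) * (\<integral>x. tail (real R) x \<partial>\<mu>) < \<delta>"
      by (rule order_tendstoD) (use \<delta> in simp)
    then obtain R0 :: nat where "(2 * B + 1) * (\<integral>x. tail (real R0) x \<partial>\<mu>) < \<delta>"
      by (auto simp: eventually_sequentially)
    then obtain R :: real where R: "R \<ge> 0" "(2 * B + 1) * (\<integral>x. tail R x \<partial>\<mu>) < \<delta>"
      by (metis of_nat_0_le_iff)
    \<comment> \<open>Chosen so that coordinates up to \<open>R + 1\<close> are scaled into the
      interval where \<open>arcsin\<close> inverts \<open>sin\<close>.\<close>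
    define T where "T = (R + 1) / (pi / 2)"
    have T: "T > 0" using R by (simp add: T_def)
    \<comment> \<open>A left inverse of \<open>fold_sin T\<close> on the box. It is continuous on
      the cube, so the Weierstrass theorem applies to \<open>f\<close> composed with
      \<open>w\<close>.\<close>
    define w where "w y = (\<Sum>b\<in>Basis. (T * arcsin (y \<bullet> b)) *\<^sub>R b)" for y :: 'a
    have "continuous_on (cbox (- One) One) (\<lambda>y. f (w y))"
      unfolding w_def
      by (intro continuous_on_compose2[OF f] continuous_intros) (auto simp: mem_box)
    from Stone_Weierstrass_real_polynomial_function[OF compact_cbox this \<delta>(1)]
    obtain g where g: "real_polynomial_function g" "\<And>y. y \<in> cbox (- One) One \<Longrightarrow> \<bar>f (w y) - g y\<bar> < \<delta>"
      by blast
    define h where "h x = g (fold_sin T x)" for x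
    have h: "trig_poly h" unfolding h_def[abs_def] by (rule trig_poly_polynomial_fold_sin[OF g(1)])
    have h_le: "\<bar>f (w (fold_sin T x)) - h x\<bar> < \<delta>" for x
      unfolding h_def by (rule g(2)[OF fold_sin_in_cbox])
    have fh: "\<bar>f x - h x\<bar> \<le> \<delta> + (2 * B + 1) * tail R x" for x
    proof (cases "\<forall>b\<in>Basis. \<bar>x \<bullet> b\<bar> \<le> R + 1")
      case True
      have "arcsin (fold_sin T x \<bullet> b) = x \<bullet> b / T" if "b \<in> Basis" for b
      proof -
        have "fold_sin T x \<bullet> b = sin (x \<bullet> b / T)"
          using that by (simp add: fold_sin_def inner_sum_left inner_Basis if_distrib sum.If_cases
            cong: if_cong)
        moreover have "\<bar>x \<bullet> b\<bar> / T \<le> pi / 2"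
        proof -
          have "pi / 2 * T = R + 1" by (simp add: T_def)
          then have "\<bar>x \<bullet> b\<bar> \<le> pi / 2 * T" using True that by metis
          then show ?thesis using T by (simp add: field_simps)
        qed
        then have "\<bar>x \<bullet> b / T\<bar> \<le> pi / 2" using T by (simp add: abs_divide)
        then have "- (pi / 2) \<le> x \<bullet> b / T" "x \<bullet> b / T \<le> pi / 2" by linarith+
        ultimately show ?thesis by (simp only: arcsin_sin)
      qed
      then have "w (fold_sin T x) = (\<Sum>b\<in>Basis. (x \<bullet> b) *\<^sub>R b)"
        unfolding w_def using T by (intro sum.cong) auto
      then have "w (fold_sin T x) = x" by (simp add: euclidean_representation)
      then have "\<bar>f x - h x\<bar> < \<delta>" using h_le[of x] by simp
      moreover have "0 \<le> (2 * B + 1) * tail R x"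
        unfolding tail_def using B0 by (intro mult_nonneg_nonneg sum_nonneg) (auto simp: ramp_range)
      ultimately show ?thesis by linarith
    next
      case False
      then obtain b where b: "b \<in> Basis" "\<bar>x \<bullet> b\<bar> > R + 1" by auto
      then have "1 = ramp R (x \<bullet> b)" by (simp add: ramp_def)
      also have "\<dots> \<le> tail R x"
        unfolding tail_def using b by (intro member_le_sum) (auto simp: ramp_range)
      finally have "(2 * B + 1) * 1 \<le> (2 * B + 1) * tail R x" using B0
        by (intro mult_left_mono) auto
      \<comment> \<open>Off the box \<open>w (fold_sin T x)\<close> need not be \<open>x\<close>,
        but \<open>h x\<close> is still within \<delta> of a value of \<open>f\<close>.\<close>
      moreover have "\<bar>f x - h x\<bar> \<le> 2 * B + 1"
        using B[of x] B[of "w (fold_sin T x)"] h_le[of x] \<delta> by linarith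
      ultimately have "\<bar>f x - h x\<bar> \<le> (2 * B + 1) * tail R x" by (simp only: mult_1_right)
      then show ?thesis using \<delta>(1) by (simp add: add_increasing)
    qed
    note trig = trig_poly_integral_tendsto[OF M \<mu> conv h]
    have int_fh: "\<bar>(\<integral>x. f x \<partial>\<nu>) - (\<integral>x. h x \<partial>\<nu>)\<bar> \<le> \<delta> + (2 * B + 1) * (\<integral>x. tail R x \<partial>\<nu>)"
      if \<nu>: "prob_space \<nu>" "sets \<nu> = sets borel" and hi: "integrable \<nu> h" for \<nu>
    proof -
      interpret prob_space \<nu> by fact
      have fi: "integrable \<nu> f"
        by (rule integrable_const_bound[of _ B])
          (use B f in \<open>auto intro!: borel_measurable_continuous_onI simp: measurable_cong_sets[OF
            \<nu>(2) refl]\<close>)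
      have "(\<integral>x. f x \<partial>\<nu>) - (\<integral>x. h x \<partial>\<nu>) = (\<integral>x. f x - h x \<partial>\<nu>)" using fi hi by simp
      also have "\<bar>\<dots>\<bar> \<le> (\<integral>x. \<bar>f x - h x\<bar> \<partial>\<nu>)" by (rule integral_abs_bound)
      also have "\<dots> \<le> (\<integral>x. \<delta> + (2 * B + 1) * tail R x \<partial>\<nu>)"
        using fi hi tail_int[OF \<nu>] by (intro integral_mono fh) auto
      also have "\<dots> = \<delta> + (2 * B + 1) * (\<integral>x. tail R x \<partial>\<nu>)"
        using tail_int[OF \<nu>] prob_space by simp
      finally show ?thesis .
    qed
    have "(\<lambda>n. (2 * B + 1) * (\<integral>x. tail R x \<partial>M n)) \<longlonglongrightarrow> (2 * B + 1) * (\<integral>x. tail R x \<partial>\<mu>)"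
      unfolding tail_eq[OF \<mu>] tail_eq[OF M]
      by (intro tendsto_mult tendsto_const tendsto_sum ramp_integral_tendsto M \<mu> conv)
    then have 1: "\<forall>\<^sub>F n in sequentially. (2 * B + 1) * (\<integral>x. tail R x \<partial>M n) < \<delta>"
      by (rule order_tendstoD) (use R in simp)
    have 2: "\<forall>\<^sub>F n in sequentially. dist (\<integral>x. h x \<partial>M n) (\<integral>x. h x \<partial>\<mu>) < \<delta>"
      using trig \<delta> by (intro tendstoD) auto
    from 1 2 show "\<forall>\<^sub>F n in sequentially. dist (\<integral>x. f x \<partial>M n) (\<integral>x. f x \<partial>\<mu>) < \<epsilon>"
    proof eventually_elim
      case (elim n)
      have "integrable (M n) h" "integrable \<mu> h" using trig by auto
      from int_fh[OF M this(1)] int_fh[OF \<mu> this(2)] elim R \<delta> show ?case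
        unfolding dist_real_def by linarith
    qed
  qed
qed

section \<open>Gaussian vectors\<close>

text \<open>Cholesky factorization by induction on the index set: split off the pivot \<alpha> at
  \<open>a\<close> and factor the Schur complement. A zero pivot forces its row to vanish, and
  division by zero yielding zero then makes the same formulas valid.\<close>

lemma pos_semidefinite_factorization:
  fixes K :: "'i \<Rightarrow> 'i \<Rightarrow> real"
  assumes "finite I" "\<And>i j. i \<in> I \<Longrightarrow> j \<in> I \<Longrightarrow> K i j = K j i"
    "\<And>x. 0 \<le> (\<Sum>i\<in>I. \<Sum>j\<in>I. x i * x j * K i j)"
  shows "\<exists>w. \<forall>i\<in>I. \<forall>j\<in>I. K i j = (\<Sum>k\<in>I. w i k * w j k)"
  using assms
proof (induction I arbitrary: K rule: finite_induct)
  case (insert a I)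
  define \<alpha> where "\<alpha> = K a a"
  have sym: "K i a = K a i" if "i \<in> I" for i using insert.prems(1)[of i a] that by simp
  have form: "(\<Sum>i\<in>insert a I. \<Sum>j\<in>insert a I. x i * x j * K i j) =
      (\<Sum>i\<in>I. \<Sum>j\<in>I. x i * x j * K i j) + 2 * x a * (\<Sum>j\<in>I. K a j * x j) + \<alpha> * (x a)\<^sup>2" for x
  proof -
    have "(\<Sum>i\<in>I. x i * x a * K i a) = x a * (\<Sum>j\<in>I. K a j * x j)"
      unfolding sum_distrib_left by (intro sum.cong refl) (simp add: sym)
    moreover have "(\<Sum>j\<in>I. x a * x j * K a j) = x a * (\<Sum>j\<in>I. K a j * x j)"
      unfolding sum_distrib_left by (intro sum.cong refl) simp
    ultimately show ?thesis
      using insert.hyps by (simp add: sum.distrib \<alpha>_def power2_eq_square)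
  qed
  note pos = insert.prems(2)[unfolded form]
  have \<alpha>0: "\<alpha> \<ge> 0" using pos[of "\<lambda>i. if i = a then 1 else 0"] insert.hyps by (simp add: sum.neutral)
  have zero: "K a j = 0" if "\<alpha> = 0" "j \<in> I" for j
  proof (rule ccontr)
    assume nz: "K a j \<noteq> 0"
    have ja: "j \<noteq> a" using that insert.hyps by auto
    \<comment> \<open>With coordinates \<open>s\<close> at \<open>a\<close> and 1 at
      \<open>j\<close>, the form takes the value \<open>K j j + 2 * s * K a j\<close>, which this
      \<open>s\<close> makes equal to \<open>- 1\<close>.\<close>
    define s where "s = - (K j j + 1) / (2 * K a j)"
    define x where "x i = (if i = a then s else if i = j then 1 else 0)" for i
    have xI: "x i = (if i = j then 1 else 0)" if "i \<in> I" for i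
      using that insert.hyps by (auto simp: x_def)
    have "(\<Sum>i\<in>I. \<Sum>k\<in>I. x i * x k * K i k) = (\<Sum>i\<in>I. \<Sum>k\<in>I. if i = j then if k
      = j then K j j else 0 else 0)"
      by (intro sum.cong refl) (simp add: xI)
    also have "\<dots> = (\<Sum>i\<in>I. if i = j then K j j else 0)"
      using insert.hyps that by (intro sum.cong refl) simp
    also have "\<dots> = K j j" using insert.hyps that by simp
    finally have 1: "(\<Sum>i\<in>I. \<Sum>k\<in>I. x i * x k * K i k) = K j j" .
    have "(\<Sum>k\<in>I. K a k * x k) = (\<Sum>k\<in>I. if k = j then K a j else 0)"
      by (intro sum.cong refl) (simp add: xI)
    also have "\<dots> = K a j" using insert.hyps that by simp
    finally have "0 \<le> K j j + 2 * s * K a j" using pos[of x] that 1 by (simp add: x_def)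
    moreover have "2 * s * K a j = - (K j j + 1)" using nz by (simp add: s_def field_simps)
    ultimately show False by simp
  qed
  define K' where "K' i j = K i j - K a i * K a j / \<alpha>" for i j
  have "\<exists>w. \<forall>i\<in>I. \<forall>j\<in>I. K' i j = (\<Sum>k\<in>I. w i k * w j k)"
  proof (rule insert.IH)
    show "K' i j = K' j i" if "i \<in> I" "j \<in> I" for i j
      using insert.prems(1)[of i j] that by (simp add: K'_def)
    fix x :: "'i \<Rightarrow> real"
    define s where "s = (\<Sum>j\<in>I. K a j * x j)"
    \<comment> \<open>For a positive pivot, this value at \<open>a\<close> minimises the form in
      that coordinate; completing the square leaves the Schur complement.\<close>
    define y where "y = x(a := - s / \<alpha>)"
    have yI: "y i = x i" if "i \<in> I" for i using that insert.hyps by (auto simp: y_def)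
    have "0 \<le> (\<Sum>i\<in>I. \<Sum>j\<in>I. x i * x j * K i j) + 2 * (- s / \<alpha>) * s + \<alpha> * (- s / \<alpha>)\<^sup>2"
    proof -
      have "(\<Sum>i\<in>I. \<Sum>j\<in>I. y i * y j * K i j) = (\<Sum>i\<in>I. \<Sum>j\<in>I. x i * x j * K i j)" "(\<Sum>j\<in>I. K a j * y j)
        = s"
        unfolding s_def by (intro sum.cong refl; simp add: yI)+
      moreover have "y a = - s / \<alpha>" by (simp add: y_def)
      ultimately show ?thesis using pos[of y] by simp
    qed
    also have "\<dots> = (\<Sum>i\<in>I. \<Sum>j\<in>I. x i * x j * K i j) - s * s / \<alpha>"
      by (cases "\<alpha> = 0") (auto simp: power2_eq_square field_simps)
    also have "s * s / \<alpha> = (\<Sum>i\<in>I. \<Sum>j\<in>I. x i * x j * (K a i * K a j / \<alpha>))"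
      unfolding s_def sum_product sum_divide_distrib by (intro sum.cong refl) simp
    also have "(\<Sum>i\<in>I. \<Sum>j\<in>I. x i * x j * K i j) - \<dots> = (\<Sum>i\<in>I. \<Sum>j\<in>I. x i * x j * K' i j)"
      by (simp add: K'_def sum_subtractf right_diff_distrib)
    finally show "0 \<le> (\<Sum>i\<in>I. \<Sum>j\<in>I. x i * x j * K' i j)" .
  qed
  then obtain w' where w': "\<And>i j. i \<in> I \<Longrightarrow> j \<in> I \<Longrightarrow> K' i j = (\<Sum>k\<in>I. w' i k * w' j k)" by blast
  define w where "w i k = (if k = a then K a i / sqrt \<alpha> else if i = a then 0 else w' i k)" for i k
  have aI: "a \<notin> I" by fact
  have sum_w: "(\<Sum>k\<in>insert a I. w i k * w j k) = K a i * K a j / \<alpha> + (if i = a \<or> j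
    = a then 0 else \<Sum>k\<in>I. w' i k * w' j k)" for i j
  proof -
    have "(\<Sum>k\<in>I. w i k * w j k) = (\<Sum>k\<in>I. if i = a \<or> j = a then 0 else w' i k * w' j k)"
      using aI by (intro sum.cong refl) (auto simp: w_def)
    moreover have "w i a * w j a = K a i * K a j / \<alpha>" using \<alpha>0 by (simp add: w_def)
    ultimately show ?thesis using insert.hyps by simp
  qed
  have "K i j = (\<Sum>k\<in>insert a I. w i k * w j k)" if ij: "i \<in> insert a I" "j \<in> insert a I" for i j
  proof -
    have *: "K a j = K a a * K a j / \<alpha>" if "j \<in> insert a I" for j
      using zero[of j] that by (cases "\<alpha> = 0") (auto simp: \<alpha>_def)
    consider "i = a" | "j = a" "i \<in> I" | "i \<in> I" "j \<in> I" using ij by blast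
    then show ?thesis
    proof cases
      case 1 then show ?thesis unfolding sum_w using *[OF ij(2)] by simp
    next
      case 2 then show ?thesis unfolding sum_w using *[OF ij(1)] sym[of i]
        by (simp add: mult.commute)
    next
      case 3 then show ?thesis unfolding sum_w using w'[of i j] aI by (auto simp: K'_def)
    qed
  qed
  then show ?case by blast
qed simp

section \<open>Univariate normal laws\<close>

text \<open>Scaling a standard normal variable covers the point mass and the density case together,
  so characteristic function and moments need no case distinction.\<close>

lemma normal_law_eq_distr:
  assumes "v \<ge> 0"
  shows "normal_law 0 v = distr std_normal_distribution borel (\<lambda>x. sqrt v * x)"
proof (cases "v = 0")
  case True
  interpret std: real_distribution std_normal_distribution by (rule real_dist_normal_dist)
  have "distr std_normal_distribution borel (\<lambda>x. 0) = return borel (0::real)"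
    by (rule std.distr_const) simp
  then show ?thesis using True by (simp add: normal_law_def)
next
  case False
  interpret std: real_distribution std_normal_distribution by (rule real_dist_normal_dist)
  have "distributed std_normal_distribution lborel (\<lambda>x. x) (normal_density 0 1)"
    by (auto simp: distributed_def distr_id2 intro!: distr_id2)
  from std.normal_density_affine[OF this, of "sqrt v" 0] False assms
  have "distributed std_normal_distribution lborel (\<lambda>x. sqrt v * x) (normal_density 0 (sqrt v))"
    by simp
  then have "distr std_normal_distribution lborel (\<lambda>x. sqrt v * x)
    = density lborel (normal_density 0 (sqrt v))"
    by (simp add: distributed_def)
  moreover have "distr std_normal_distribution lborel (\<lambda>x. sqrt v * x)
    = distr std_normal_distribution borel (\<lambda>x. sqrt v * x)"
    by (rule distr_cong) auto
  ultimately show ?thesis using False by (simp add: normal_law_def)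
qed

lemma normal_law_char:
  assumes "v \<ge> 0"
  shows "char (normal_law 0 v) s = exp (- (s\<^sup>2 * v / 2))"
proof -
  have "char (normal_law 0 v) s = char std_normal_distribution (s * sqrt v)"
    unfolding normal_law_eq_distr[OF assms] char_def
    by (subst integral_distr) (auto simp: mult.assoc)
  then show ?thesis using assms by (simp add: char_std_normal_distribution power_mult_distrib)
qed

lemma normal_law_moments:
  assumes "v \<ge> 0"
  shows "(\<integral>x. x \<partial>normal_law 0 v) = 0" "integrable (normal_law 0 v) (\<lambda>x. x\<^sup>2)" "(\<integral>x. x\<^sup>2 \<partial>normal_law
    0 v) = v"
proof -
  have 1: "(\<integral>x. x \<partial>std_normal_distribution) = 0"
    using integral_std_normal_distribution_moment_odd[of 1] by simp
  have 2: "(\<integral>x. x\<^sup>2 \<partial>std_normal_distribution) = 1"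
    using std_normal_distribution_even_moments(1)[of 1] by simp
  show "(\<integral>x. x \<partial>normal_law 0 v) = 0" "(\<integral>x. x\<^sup>2 \<partial>normal_law 0 v) = v"
    unfolding normal_law_eq_distr[OF assms]
    by (subst integral_distr; simp add: 1 2 power_mult_distrib assms)+
  show "integrable (normal_law 0 v) (\<lambda>x. x\<^sup>2)"
    unfolding normal_law_eq_distr[OF assms]
    by (subst integrable_distr_eq) (auto simp: power_mult_distrib intro!: integrable_mult_right
      integrable_std_normal_distribution_moment)
qed

lemma real_distribution_normal_law: "v \<ge> 0 \<Longrightarrow> real_distribution (normal_law 0 v)"
  using prob_space.real_distribution_distr[OF real_distribution.axioms(1)[OF real_dist_normal_dist],
    of "\<lambda>x. sqrt v * x"]
  by (simp add: normal_law_eq_distr)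

lemma inner_matrix_vector: "t \<bullet> (S *v t) = (\<Sum>i\<in>UNIV. \<Sum>j\<in>UNIV. t $ i * t $ j * S $ i $ j)"
  for S :: "real ^ 'd ^ 'd"
  by (simp add: inner_vec_def matrix_vector_mult_def sum_distrib_left ac_simps)

section \<open>Gaussian vectors and their characteristic functions\<close>

text \<open>A factorization of \<open>S\<close> with factor \<open>w\<close> gives the law as the
  image of independent standard normals under the linear map \<open>w\<close>. No invertibility of
  \<open>S\<close> enters, and the integral factors by independence.\<close>

lemma gaussian_characteristic_function_exists:
  fixes S :: "real ^ 'd ^ 'd"
  assumes "pos_semidefinite S"
  shows "\<exists>\<mu>. prob_space \<mu> \<and> sets \<mu> = sets borel \<and> (\<forall>t. (\<integral>x. cis (t \<bullet> x) \<partial>\<mu>)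
    = exp (- ((t \<bullet> (S *v t)) / 2)))"
proof -
  have S: "transpose S = S" "\<And>x. 0 \<le> x \<bullet> (S *v x)" using assms by (auto simp: pos_semidefinite_def)
  have "\<exists>w. \<forall>i\<in>UNIV. \<forall>j\<in>UNIV. S $ i $ j = (\<Sum>k\<in>(UNIV::'d set). w i k * w j k)"
  proof (rule pos_semidefinite_factorization[where K = "\<lambda>i j. S $ i $ j"])
    show "S $ i $ j = S $ j $ i" for i j using S(1) by (metis transpose_def vec_lambda_beta)
    show "0 \<le> (\<Sum>i\<in>UNIV. \<Sum>j\<in>UNIV. x i * x j * S $ i $ j)" for x
      using S(2)[of "\<chi> i. x i"] by (simp add: inner_matrix_vector)
  qed simp
  then obtain w :: "'d \<Rightarrow> 'd \<Rightarrow> real" where w: "\<And>i j. S $ i $ j = (\<Sum>k\<in>UNIV. w i k * w j k)" by blast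
  interpret std: real_distribution std_normal_distribution by (rule real_dist_normal_dist)
  interpret P: product_prob_space "\<lambda>_::'d. std_normal_distribution" UNIV by unfold_locales
  define N where "N = Pi\<^sub>M (UNIV :: 'd set) (\<lambda>_. std_normal_distribution)"
  interpret N: prob_space N unfolding N_def by (rule P.P.prob_space_axioms)
  define g where "g \<xi> = (\<chi> i. \<Sum>k\<in>UNIV. w i k * \<xi> k)" for \<xi> :: "'d \<Rightarrow> real"
  have comp: "(\<lambda>\<xi>. \<xi> k) \<in> borel_measurable N" for k
    unfolding N_def using measurable_component_singleton[of k UNIV "\<lambda>_. std_normal_distribution"]
    by simp
  have g: "g \<in> borel_measurable N"
    by (subst borel_measurable_euclidean_space)
      (auto simp: g_def Basis_vec_def inner_axis intro!: borel_measurable_sum borel_measurable_times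
        comp)
  have "(\<integral>x. cis (t \<bullet> x) \<partial>distr N borel g) = exp (- ((t \<bullet> (S *v t)) / 2))" for t
  proof -
    define c where "c k = (\<Sum>i\<in>UNIV. t $ i * w i k)" for k
    have tg: "t \<bullet> g \<xi> = (\<Sum>k\<in>UNIV. c k * \<xi> k)" for \<xi>
      unfolding g_def c_def inner_vec_def
      by (simp add: sum_distrib_left sum_distrib_right mult.assoc) (rule sum.swap)
    have "t \<bullet> (S *v t) = (\<Sum>i\<in>UNIV. \<Sum>j\<in>UNIV. \<Sum>k\<in>UNIV. (t $ i * w i k) * (t $ j * w j k))"
      unfolding inner_matrix_vector w sum_distrib_left by (simp add: ac_simps)
    also have "\<dots> = (\<Sum>i\<in>UNIV. \<Sum>k\<in>UNIV. \<Sum>j\<in>UNIV. (t $ i * w i k) * (t $ j * w j k))"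
      by (intro sum.cong refl sum.swap)
    also have "\<dots> = (\<Sum>k\<in>UNIV. \<Sum>i\<in>UNIV. \<Sum>j\<in>UNIV. (t $ i * w i k) * (t $ j * w j k))"
      by (rule sum.swap)
    also have "\<dots> = (\<Sum>k\<in>UNIV. (c k)\<^sup>2)"
      by (simp add: c_def power2_eq_square sum_product)
    finally have quad: "t \<bullet> (S *v t) = (\<Sum>k\<in>UNIV. (c k)\<^sup>2)" .
    have cis_sum: "cis (\<Sum>k\<in>I. f k) = (\<Prod>k\<in>I. cis (f k))" if "finite I" for I :: "'d set" and f
      using that by (induction I rule: finite_induct) (auto simp: cis_mult[symmetric])
    have "(\<integral>x. cis (t \<bullet> x) \<partial>distr N borel g) = (\<integral>\<xi>. cis (t \<bullet> g \<xi>) \<partial>N)"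
      by (rule integral_distr[OF g]) (auto intro!: borel_measurable_continuous_onI
        continuous_intros)
    also have "\<dots> = (\<integral>\<xi>. (\<Prod>k\<in>UNIV. cis (c k * \<xi> k)) \<partial>N)"
      by (simp add: tg cis_sum)
    also have "\<dots> = (\<Prod>k\<in>UNIV. \<integral>y. cis (c k * y) \<partial>std_normal_distribution)"
      unfolding N_def
    proof (rule P.product_integral_prod)
      show "integrable std_normal_distribution (\<lambda>y. cis (c k * y))" for k
        using std.integrable_iexp[of "\<lambda>y. c k * y"] by (simp add: cis_conv_exp)
    qed simp
    also have "\<dots> = (\<Prod>k\<in>UNIV. char std_normal_distribution (c k))"
      by (simp add: char_def cis_conv_exp)
    also have "\<dots> = exp (- ((t \<bullet> (S *v t)) / 2))"
      unfolding char_std_normal_distribution quad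
      by (simp add: sum_divide_distrib flip: of_real_prod exp_sum sum_negf)
    finally show ?thesis .
  qed
  moreover have "prob_space (distr N borel g)" by (rule N.prob_space_distr[OF g])
  ultimately show ?thesis by (intro exI[of _ "distr N borel g"]) simp
qed

text \<open>Along each line the characteristic function is that of a centred normal law, so Levy
  uniqueness identifies every one-dimensional projection. Means and covariances are then read off
  from these projections.\<close>

lemma centered_gaussian_law_if_characteristic_function:
  fixes S :: "real ^ 'd ^ 'd"
  assumes "pos_semidefinite S" and \<mu>: "prob_space \<mu>" "sets \<mu> = sets borel"
    and ch: "\<And>t. (\<integral>x. cis (t \<bullet> x) \<partial>\<mu>) = exp (- ((t \<bullet> (S *v t)) / 2))"
  shows "centered_gaussian_law S \<mu>"
proof -
  interpret prob_space \<mu> by fact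
  have S: "transpose S = S" "\<And>x. 0 \<le> x \<bullet> (S *v x)" using assms by (auto simp: pos_semidefinite_def)
  have meas: "(\<lambda>x. t \<bullet> x) \<in> borel_measurable \<mu>" for t
    by (simp add: measurable_cong_sets[OF \<mu>(2) refl])
  have law: "distr \<mu> borel (\<lambda>x. t \<bullet> x) = normal_law 0 (t \<bullet> (S *v t))" for t
  proof (rule Levy_uniqueness)
    show "real_distribution (distr \<mu> borel (\<lambda>x. t \<bullet> x))" by (rule real_distribution_distr[OF meas])
    show "real_distribution (normal_law 0 (t \<bullet> (S *v t)))"
      by (rule real_distribution_normal_law[OF S(2)])
    show "char (distr \<mu> borel (\<lambda>x. t \<bullet> x)) = char (normal_law 0 (t \<bullet> (S *v t)))"
    proof
      fix s
      have "char (distr \<mu> borel (\<lambda>x. t \<bullet> x)) s = (\<integral>x. cis ((s *\<^sub>R t) \<bullet> x) \<partial>\<mu>)"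
        unfolding char_def by (subst integral_distr[OF meas]) (auto simp: cis_conv_exp)
      also have "\<dots> = exp (- (s\<^sup>2 * (t \<bullet> (S *v t)) / 2))"
        unfolding ch by (simp add: power2_eq_square matrix_vector_mult_scaleR mult.assoc)
      finally show "char (distr \<mu> borel (\<lambda>x. t \<bullet> x)) s = char (normal_law 0 (t \<bullet> (S *v t))) s"
        by (simp add: normal_law_char[OF S(2)])
    qed
  qed
  have sq_int: "integrable \<mu> (\<lambda>x. (t \<bullet> x)\<^sup>2)" for t
    using normal_law_moments(2)[OF S(2), of t] unfolding law[symmetric]
    by (subst (asm) integrable_distr_eq[OF meas]) auto
  have sq: "(\<integral>x. (t \<bullet> x)\<^sup>2 \<partial>\<mu>) = t \<bullet> (S *v t)" for t
    using normal_law_moments(3)[OF S(2), of t] unfolding law[symmetric]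
    by (subst (asm) integral_distr[OF meas]) auto
  have mean: "(\<integral>x. t \<bullet> x \<partial>\<mu>) = 0" for t
    using normal_law_moments(1)[OF S(2), of t] unfolding law[symmetric]
    by (subst (asm) integral_distr[OF meas]) auto
  have comp: "axis i 1 \<bullet> x = x $ i" for i and x :: "real ^ 'd"
    by (simp add: inner_axis')
  have quad: "(axis i 1 + c *\<^sub>R axis j 1) \<bullet> (S *v (axis i 1 + c *\<^sub>R axis j 1)) = S $ i $ i
    + 2 * c * S $ i $ j + c\<^sup>2 * S $ j $ j" for i j c
  proof -
    have "S $ j $ i = S $ i $ j" using S(1) by (metis transpose_def vec_lambda_beta)
    moreover have "axis i 1 \<bullet> (S *v axis j 1) = S $ i $ j" for i j
      by (simp add: comp matrix_vector_mul_component inner_axis)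
    ultimately show ?thesis
      by (simp add: matrix_vector_right_distrib inner_add_left inner_add_right power2_eq_square
        algebra_simps
          matrix_vector_mult_scaleR)
  qed
  have "(\<integral>x. x $ i * x $ j \<partial>\<mu>) = S $ i $ j" for i j
  proof -
    \<comment> \<open>Polarization: the covariance of two coordinates is a quarter of the difference
      of the second moments along \<open>?p\<close> and \<open>?m\<close>.\<close>
    let ?p = "axis i 1 + 1 *\<^sub>R axis j 1 :: real ^ 'd" and ?m = "axis i 1
      + (- 1) *\<^sub>R axis j 1 :: real ^ 'd"
    have "(\<integral>x. x $ i * x $ j \<partial>\<mu>) = (\<integral>x. ((?p \<bullet> x)\<^sup>2 - (?m \<bullet> x)\<^sup>2) / 4 \<partial>\<mu>)"
      by (intro Bochner_Integration.integral_cong refl) (simp add: inner_add_left inner_diff_left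
        comp power2_eq_square field_simps)
    also have "\<dots> = (?p \<bullet> (S *v ?p) - ?m \<bullet> (S *v ?m)) / 4"
      using sq_int by (simp only: Bochner_Integration.integral_diff sq integral_divide_zero)
    also have "\<dots> = S $ i $ j" unfolding quad by simp
    finally show ?thesis .
  qed
  moreover have "(\<integral>x. x $ i \<partial>\<mu>) = 0" for i using mean[of "axis i 1"] by (simp add: comp)
  ultimately show ?thesis
    unfolding centered_gaussian_law_def gaussian_vector_law_def using \<mu> law S(2) by blast
qed

section \<open>The central limit theorem\<close>

lemma integral_pmf_of_set_lessThan:
  fixes f :: "nat \<Rightarrow> 'a::{banach, second_countable_topology}"
  assumes "N > 0"
  shows "(\<integral>n. f n \<partial>measure_pmf (pmf_of_set {..<N})) = avg N f"
proof -
  have ne: "{..<N} \<noteq> {}" using assms by auto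
  have "(\<integral>n. f n \<partial>measure_pmf (pmf_of_set {..<N})) = (\<Sum>n<N. pmf (pmf_of_set {..<N}) n *\<^sub>R f n)"
    using ne by (intro integral_measure_pmf) auto
  also have "\<dots> = (\<Sum>n<N. (1 / real N) *\<^sub>R f n)"
    using ne by (intro sum.cong refl) simp
  finally show ?thesis by (simp add: avg_def scaleR_sum_right[symmetric] divide_inverse)
qed

theorem theorem1:
  fixes q :: nat and A :: "'d::finite \<Rightarrow> nat"
  assumes "q \<ge> 2" and "\<And>i. A i > 0"
  shows "\<exists>S :: real ^ 'd ^ 'd.
    pos_semidefinite S \<and>
    (\<exists>\<mu>. centered_gaussian_law S \<mu> \<and>
      converges_in_law
        (\<lambda>N. distr (measure_pmf (pmf_of_set {..<N})) borel
          (\<lambda>n. \<chi> i. (real (digit_sum q (A i * n)) - (real q - 1) / 2 * log (real q) (real N))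
                     / sqrt (log (real q) (real N))))
        \<mu>) \<and>
    (prime q \<and> (\<forall>i. \<not> q dvd A i) \<longrightarrow>
      S = (\<chi> i j. ((real q)\<^sup>2 - 1) / 12 *
                   ((real (gcd (A i) (A j)))\<^sup>2 / (real (A i) * real (A j)))))"
proof -
  interpret multiplied_digits q A using assms by unfold_locales
  define S :: "real ^ 'd ^ 'd" where "S = (\<chi> i j. \<Sigma> i j)"
  define X where "X N n = (\<chi> i. (real (digit_sum q (A i * n)) - (real q
    - 1) / 2 * lg N) / sqrt (lg N))" for N n
  \<comment> \<open>Scaling the weights by \<open>real q - 1\<close> absorbs the factor
    \<open>(real q - 1)\<^sup>2\<close> of \<Sigma>.\<close>
  have quad: "t \<bullet> (S *v t) = saw_var (\<lambda>i. (real q - 1) * t $ i)" for t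
    unfolding inner_matrix_vector saw_var_def S_def \<Sigma>_def
    by (intro sum.cong refl) (simp add: power2_eq_square)
  have psd: "pos_semidefinite S"
    unfolding pos_semidefinite_def quad using saw_var_nonneg \<Sigma>_sym
    by (auto simp: S_def transpose_def)
  obtain \<mu> where \<mu>: "prob_space \<mu>" "sets \<mu> = sets borel"
    and ch: "\<And>t. (\<integral>x. cis (t \<bullet> x) \<partial>\<mu>) = exp (- ((t \<bullet> (S *v t)) / 2))"
    using gaussian_characteristic_function_exists[OF psd] by blast
  have "converges_in_law (\<lambda>N. distr (measure_pmf (pmf_of_set {..<N})) borel (X N)) \<mu>"
  proof (rule converges_in_law_if_characteristic_functions_converge)
    show "prob_space (distr (measure_pmf (pmf_of_set {..<N})) borel (X N))" for N
      by (rule measure_pmf.prob_space_distr) simp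
    fix t :: "real ^ 'd"
    \<comment> \<open>The index \<open>N = 0\<close> is set aside because \<open>{..<N}\<close> is
      empty there; one index does not affect the limit.\<close>
    have "(\<integral>x. cis (t \<bullet> x) \<partial>distr (measure_pmf (pmf_of_set {..<N})) borel (X N)) = \<phi> (($) t) N"
      if "N > 0" for N
    proof -
      have "(\<integral>x. cis (t \<bullet> x) \<partial>distr (measure_pmf (pmf_of_set {..<N})) borel (X N)) =
          (\<integral>n. cis (t \<bullet> X N n) \<partial>measure_pmf (pmf_of_set {..<N}))"
        by (rule integral_distr) (auto intro!: borel_measurable_continuous_onI continuous_intros)
      also have "\<dots> = avg N (\<lambda>n. cis (t \<bullet> X N n))" by (rule integral_pmf_of_set_lessThan[OF that])
      also have "\<dots> = \<phi> (($) t) N" by (simp add: \<phi>_def X_def inner_vec_def)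
      finally show ?thesis .
    qed
    then have "\<forall>\<^sub>F N in sequentially. \<phi> (($) t) N
      = (\<integral>x. cis (t \<bullet> x) \<partial>distr (measure_pmf (pmf_of_set {..<N})) borel (X N))"
      by (intro eventually_mono[OF eventually_gt_at_top[of 0]]) simp
    with \<phi>_limit[of "($) t"]
    show "(\<lambda>N. \<integral>x. cis (t \<bullet> x) \<partial>distr (measure_pmf (pmf_of_set {..<N})) borel (X N))
      \<longlonglongrightarrow> (\<integral>x. cis (t \<bullet> x) \<partial>\<mu>)"
      unfolding ch quad by (rule Lim_transform_eventually)
  qed (simp_all add: \<mu>)
  moreover have "centered_gaussian_law S \<mu>"
    by (rule centered_gaussian_law_if_characteristic_function[OF psd \<mu> ch])
  moreover have "S = (\<chi> i j. ((real q)\<^sup>2 - 1) / 12 * ((real (gcd (A i) (A j)))\<^sup>2 / (real (A i) *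
    real (A j))))"
    if "prime q \<and> (\<forall>i. \<not> q dvd A i)"
    using \<Sigma>_prime that by (simp add: S_def vec_eq_iff)
  ultimately show ?thesis using psd unfolding X_def by blast
qed

end
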